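(* Let $A$ generate a $C_0$-semigroup on the complex Hilbert space $H$, let $B\in\mathcal{L}(U,(\mathrm{dom}\,A^* )')$, and assume that for every $T>0$ the map $u\mapsto Lu$, $(Lu)(t)=\int_0^t e^{\mathcal{A}(t-s)}Bu(s)\,ds$, is linear and continuous from $L^2(0,T;U)$ into $L^2(0,T;H)$. If the spectrum $\sigma(A)$ has an isolated point with positive real part, then the system $\dot y=\mathcal{A}y+Bu$, $y(0)=y_0\in H$, is not NCVE.
   Context: Setting. $H$ is a complex Hilbert space with inner product $\langle\cdot,\cdot\rangle$ and norm $|\cdot|$; $A$ generates a $C_0$-semigroup $e^{At}$ on $H$; $A^*$ is its Hilbert space adjoint. The space $\mathrm{dom}\,A^*$ with the graph norm is a Hilbert space, not identified with its dual; $H$ is identified with its dual, so $\mathrm{dom}\,A^*\subset H=H'\subset(\mathrm{dom}\,A^* )'$ with continuous dense injections. $\mathcal{A}$ denotes the extension of $A$ to $(\mathrm{dom}\,A^* )'$ (the dual of $A^*\in\mathcal{L}(\mathrm{dom}\,A^*,H)$); its domain is $H$ and it generates a $C_0$-semigroup $e^{\mathcal{A}t}$ on $(\mathrm{dom}\,A^* )'$ extending $e^{At}$. $U$ is a Hilbert space. The solution of the system with initial state $y_0\in H$ and control $u\in L^2_{\rm loc}(0,+\infty;U)$ is $y^{y_0,u}(t)=e^{At}y_0+\int_0^t e^{\mathcal{A}(t-s)}Bu(s)\,ds$, which belongs to $L^2_{\rm loc}(0,+\infty;H)$ under the assumption on $L$. Definitions. $y_0\in H$ can be steered to the rest in time (at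 most) $T$ if there is a control $u\in L^2_{\rm loc}(0,+\infty;U)$ with support in $[0,T]$ such that $y^{y_0,u}$ has support in $[0,T]$ too. An element $y_0$ that can be steered to the rest is NCVE if for every $\epsilon>0$ there are a time $T_\epsilon$ and a control $u_\epsilon$ with support in $[0,T_\epsilon]$ steering $y_0$ to the rest in time at most $T_\epsilon$ with $\int_0^{+\infty}|u_\epsilon(s)|^2ds\le\epsilon^2$. The system is NCVE (null controllable with vanishing energy) if every element of $H$ is NCVE. *)

theory Defs
  imports "HOL-Analysis.Analysis" "HOL-Library.Function_Algebras"
begin

section \<open>Complex Hilbert spaces\<close>

class complex_vector = real_vector +
  fixes scaleC :: "complex \<Rightarrow> 'a \<Rightarrow> 'a"  (infixr \<open>*\<^sub>C\<close> 75)
  assumes scaleC_add_right: "a *\<^sub>C (x + y) = a *\<^sub>C x + a *\<^sub>C y"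
    and scaleC_add_left: "(a + b) *\<^sub>C x = a *\<^sub>C x + b *\<^sub>C x"
    and scaleC_scaleC: "a *\<^sub>C b *\<^sub>C x = (a * b) *\<^sub>C x"
    and scaleR_scaleC: "r *\<^sub>R x = complex_of_real r *\<^sub>C x"

text \<open>
  The inner product \<open>cinner\<close> is linear in the first and antilinear in the second argument.
  Its real part is the inner product of the underlying real Hilbert space, so norm and topology
  are the ones of \<^class>\<open>real_inner\<close>. No separability is assumed.
\<close>

class complex_hilbert = complex_vector + real_inner + banach +
  fixes cinner :: "'a \<Rightarrow> 'a \<Rightarrow> complex"
  assumes cinner_add_left: "cinner (x + y) z = cinner x z + cinner y z"
    and cinner_scaleC_left: "cinner (a *\<^sub>C x) y = a * cinner x y"
    and cinner_commute: "cinner x y = cnj (cinner y x)"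
    and Re_cinner: "Re (cinner x y) = inner x y"

instantiation complex :: complex_hilbert
begin
definition scaleC_complex :: "complex \<Rightarrow> complex \<Rightarrow> complex"
  where "scaleC_complex a x = a * x"
definition cinner_complex :: "complex \<Rightarrow> complex \<Rightarrow> complex"
  where "cinner_complex x y = x * cnj y"
instance
  by standard
    (auto simp: scaleC_complex_def cinner_complex_def algebra_simps scaleR_conv_of_real inner_complex_def)
end

text \<open>Functions carry the pointwise vector space structure.\<close>

instantiation "fun" :: (type, scaleR) scaleR
begin
definition scaleR_fun :: "real \<Rightarrow> ('a \<Rightarrow> 'b) \<Rightarrow> 'a \<Rightarrow> 'b"
  where "scaleR_fun r f = (\<lambda>x. r *\<^sub>R f x)"
instance ..
end

instance "fun" :: (type, real_vector) real_vector
  by standard (auto simp: scaleR_fun_def fun_eq_iff scaleR_add_right scaleR_add_left)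

instantiation "fun" :: (type, complex_vector) complex_vector
begin
definition scaleC_fun :: "complex \<Rightarrow> ('a \<Rightarrow> 'b) \<Rightarrow> 'a \<Rightarrow> 'b"
  where "scaleC_fun c f = (\<lambda>x. c *\<^sub>C f x)"
instance
  by standard
    (auto simp: scaleC_fun_def scaleR_fun_def fun_eq_iff scaleC_add_right scaleC_add_left
      scaleC_scaleC scaleR_scaleC)
end


section \<open>Normed spaces given by a carrier \<open>X\<close> and a norm \<open>N\<close>\<close>

text \<open>
  The space \<open>(dom A\<^sup>*)'\<close> depends on the operator \<open>A\<close> and hence is not a type. The notions needed
  both for it and for the ambient Hilbert spaces are therefore stated for a linear subspace \<open>X\<close> of
  a complex vector space and a norm \<open>N\<close> on \<open>X\<close>.
\<close>

definition bounded_clinear_on ::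
  "'a::complex_vector set \<Rightarrow> ('a \<Rightarrow> real) \<Rightarrow> 'b::complex_vector set \<Rightarrow> ('b \<Rightarrow> real) \<Rightarrow> ('a \<Rightarrow> 'b) \<Rightarrow> bool"
  where "bounded_clinear_on X N Y N' F \<longleftrightarrow>
    (\<forall>x\<in>X. F x \<in> Y) \<and>
    (\<forall>x\<in>X. \<forall>y\<in>X. F (x + y) = F x + F y) \<and>
    (\<forall>c. \<forall>x\<in>X. F (c *\<^sub>C x) = c *\<^sub>C F x) \<and>
    (\<exists>K. \<forall>x\<in>X. N' (F x) \<le> K * N x)"

definition C0_semigroup_on ::
  "'a::complex_vector set \<Rightarrow> ('a \<Rightarrow> real) \<Rightarrow> (real \<Rightarrow> 'a \<Rightarrow> 'a) \<Rightarrow> bool"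
  where "C0_semigroup_on X N S \<longleftrightarrow>
    (\<forall>t\<ge>0. bounded_clinear_on X N X N (S t)) \<and>
    (\<forall>x\<in>X. S 0 x = x) \<and>
    (\<forall>s\<ge>0. \<forall>t\<ge>0. \<forall>x\<in>X. S (s + t) x = S s (S t x)) \<and>
    (\<forall>x\<in>X. ((\<lambda>t. N (S t x - x)) \<longlongrightarrow> 0) (at_right 0))"

text \<open>The graph of the infinitesimal generator.\<close>

definition generator_on ::
  "'a::complex_vector set \<Rightarrow> ('a \<Rightarrow> real) \<Rightarrow> (real \<Rightarrow> 'a \<Rightarrow> 'a) \<Rightarrow> ('a \<times> 'a) set"
  where "generator_on X N S =
    {(x, y). x \<in> X \<and> y \<in> X \<and> ((\<lambda>t. N ((S t x - x) /\<^sub>R t - y)) \<longlongrightarrow> 0) (at_right 0)}"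

definition generates_C0_semigroup_on ::
  "'a::complex_vector set \<Rightarrow> ('a \<Rightarrow> real) \<Rightarrow> ('a \<times> 'a) set \<Rightarrow> (real \<Rightarrow> 'a \<Rightarrow> 'a) \<Rightarrow> bool"
  where "generates_C0_semigroup_on X N G S \<longleftrightarrow> C0_semigroup_on X N S \<and> generator_on X N S = G"

text \<open>
  The Bochner integral of the library is restricted to second countable spaces, so strong
  measurability and the Bochner integral are defined here by approximation with simple functions.
\<close>

definition strongly_measurable_on ::
  "'a::complex_vector set \<Rightarrow> ('a \<Rightarrow> real) \<Rightarrow> 'm measure \<Rightarrow> ('m \<Rightarrow> 'a) \<Rightarrow> bool"
  where "strongly_measurable_on X N M f \<longleftrightarrow>
    (AE t in M. f t \<in> X) \<and>
    (\<exists>s. (\<forall>n. simple_function M (s n) \<and> s n ` space M \<subseteq> X) \<and>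
         (AE t in M. (\<lambda>n. N (f t - s n t)) \<longlonglongrightarrow> 0))"

definition has_Bochner_integral_on ::
  "'a::complex_vector set \<Rightarrow> ('a \<Rightarrow> real) \<Rightarrow> 'm measure \<Rightarrow> ('m \<Rightarrow> 'a) \<Rightarrow> 'a \<Rightarrow> bool"
  where "has_Bochner_integral_on X N M f I \<longleftrightarrow>
    I \<in> X \<and> strongly_measurable_on X N M f \<and>
    (\<exists>s. (\<forall>n. Bochner_Integration.simple_bochner_integrable M (s n) \<and> s n ` space M \<subseteq> X) \<and>
         (\<lambda>n. \<integral>\<^sup>+ t. ennreal (N (f t - s n t)) \<partial>M) \<longlonglongrightarrow> 0 \<and>
         (\<lambda>n. N (Bochner_Integration.simple_bochner_integral M (s n) - I)) \<longlonglongrightarrow> 0)"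


section \<open>Unbounded operators on a complex Hilbert space\<close>

text \<open>
  An operator is given by its domain \<open>D\<close> and a function \<open>A\<close>, of which only the values on \<open>D\<close> matter.
\<close>

definition op_graph :: "'h set \<Rightarrow> ('h \<Rightarrow> 'h) \<Rightarrow> ('h \<times> 'h) set"
  where "op_graph D A = {(x, A x) | x. x \<in> D}"

definition resolvent_set :: "'h::complex_hilbert set \<Rightarrow> ('h \<Rightarrow> 'h) \<Rightarrow> complex set"
  where "resolvent_set D A =
    {z. bij_betw (\<lambda>x. z *\<^sub>C x - A x) D UNIV \<and>
        bounded_clinear_on UNIV norm UNIV norm (inv_into D (\<lambda>x. z *\<^sub>C x - A x))}"

definition spectrum :: "'h::complex_hilbert set \<Rightarrow> ('h \<Rightarrow> 'h) \<Rightarrow> complex set"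
  where "spectrum D A = - resolvent_set D A"

definition adj_dom :: "'h::complex_hilbert set \<Rightarrow> ('h \<Rightarrow> 'h) \<Rightarrow> 'h set"
  where "adj_dom D A = {\<phi>. \<exists>\<psi>. \<forall>x\<in>D. cinner (A x) \<phi> = cinner x \<psi>}"

text \<open>The description below is meaningful only for densely defined \<open>A\<close> (e.g. a generator).\<close>

definition adj :: "'h::complex_hilbert set \<Rightarrow> ('h \<Rightarrow> 'h) \<Rightarrow> 'h \<Rightarrow> 'h"
  where "adj D A \<phi> = (THE \<psi>. \<forall>x\<in>D. cinner (A x) \<phi> = cinner x \<psi>)"

definition adj_graph_norm :: "'h::complex_hilbert set \<Rightarrow> ('h \<Rightarrow> 'h) \<Rightarrow> 'h \<Rightarrow> real"
  where "adj_graph_norm D A \<phi> = sqrt ((norm \<phi>)\<^sup>2 + (norm (adj D A \<phi>))\<^sup>2)"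


section \<open>The space \<open>(dom A\<^sup>*)'\<close> and the extension of \<open>A\<close>\<close>

text \<open>
  The elements of \<open>(dom A\<^sup>*)'\<close> are the antilinear functionals on \<open>dom A\<^sup>*\<close> that are bounded for the
  graph norm. Antilinearity makes \<open>h \<mapsto> \<langle>h, \<cdot>\<rangle>\<close> a linear inclusion of \<open>H = H'\<close>. Functionals
  take the value 0 outside \<open>dom A\<^sup>*\<close>, so that equality of functionals is equality of functions.
\<close>

definition adj_dual :: "'h::complex_hilbert set \<Rightarrow> ('h \<Rightarrow> 'h) \<Rightarrow> ('h \<Rightarrow> complex) set"
  where "adj_dual D A =
    {\<psi>. (\<forall>\<phi>. \<phi> \<notin> adj_dom D A \<longrightarrow> \<psi> \<phi> = 0) \<and>
        (\<forall>\<phi>\<in>adj_dom D A. \<forall>\<eta>\<in>adj_dom D A. \<psi> (\<phi> + \<eta>) = \<psi> \<phi> + \<psi> \<eta>) \<and>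
        (\<forall>c. \<forall>\<phi>\<in>adj_dom D A. \<psi> (c *\<^sub>C \<phi>) = cnj c * \<psi> \<phi>) \<and>
        (\<exists>K. \<forall>\<phi>\<in>adj_dom D A. cmod (\<psi> \<phi>) \<le> K * adj_graph_norm D A \<phi>)}"

definition adj_dual_norm :: "'h::complex_hilbert set \<Rightarrow> ('h \<Rightarrow> 'h) \<Rightarrow> ('h \<Rightarrow> complex) \<Rightarrow> real"
  where "adj_dual_norm D A \<psi> =
    (SUP \<phi>\<in>{\<phi> \<in> adj_dom D A. adj_graph_norm D A \<phi> \<le> 1}. cmod (\<psi> \<phi>))"

definition incl :: "'h::complex_hilbert set \<Rightarrow> ('h \<Rightarrow> 'h) \<Rightarrow> 'h \<Rightarrow> 'h \<Rightarrow> complex"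
  where "incl D A h = (\<lambda>\<phi>. if \<phi> \<in> adj_dom D A then cinner h \<phi> else 0)"

text \<open>
  The graph of the extension \<open>\<A>\<close> of \<open>A\<close>: the domain is \<open>H\<close> (included in \<open>(dom A\<^sup>*)'\<close>), and
  \<open>\<A>\<close> is the dual of \<open>A\<^sup>*\<close>, i.e. \<open>\<A> h = \<langle>h, A\<^sup>* \<cdot>\<rangle>\<close>.
\<close>

definition ext_graph ::
  "'h::complex_hilbert set \<Rightarrow> ('h \<Rightarrow> 'h) \<Rightarrow> (('h \<Rightarrow> complex) \<times> ('h \<Rightarrow> complex)) set"
  where "ext_graph D A =
    {(incl D A h, \<lambda>\<phi>. if \<phi> \<in> adj_dom D A then cinner h (adj D A \<phi>) else 0) | h. True}"


section \<open>Controls and solutions\<close>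

definition L2_on :: "real set \<Rightarrow> (real \<Rightarrow> 'a::complex_hilbert) set"
  where "L2_on J = {f. strongly_measurable_on UNIV norm (lebesgue_on J) f \<and>
    integrable (lebesgue_on J) (\<lambda>t. (norm (f t))\<^sup>2)}"

definition L2_norm_on :: "real set \<Rightarrow> (real \<Rightarrow> 'a::complex_hilbert) \<Rightarrow> real"
  where "L2_norm_on J f = sqrt (\<integral>t. (norm (f t))\<^sup>2 \<partial>lebesgue_on J)"

definition L2_loc :: "(real \<Rightarrow> 'a::complex_hilbert) set"
  where "L2_loc = {f. \<forall>T>0. f \<in> L2_on {0..T}}"

text \<open>
  In the following definitions \<open>S\<close> and \<open>E\<close> stand for the semigroups generated by \<open>A\<close> on \<open>H\<close> and by
  \<open>\<A>\<close> on \<open>(dom A\<^sup>*)'\<close>.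

  \<open>has_response D A E B u t \<psi>\<close>: \<open>(L u)(t)\<close>, a Bochner integral in \<open>(dom A\<^sup>*)'\<close>, equals \<open>\<psi>\<close>.
\<close>

definition has_response ::
  "'h::complex_hilbert set \<Rightarrow> ('h \<Rightarrow> 'h) \<Rightarrow> (real \<Rightarrow> ('h \<Rightarrow> complex) \<Rightarrow> ('h \<Rightarrow> complex)) \<Rightarrow>
   ('u::complex_hilbert \<Rightarrow> ('h \<Rightarrow> complex)) \<Rightarrow> (real \<Rightarrow> 'u) \<Rightarrow> real \<Rightarrow> ('h \<Rightarrow> complex) \<Rightarrow> bool"
  where "has_response D A E B u t \<psi> \<longleftrightarrow>
    has_Bochner_integral_on (adj_dual D A) (adj_dual_norm D A) (lebesgue_on {0..t})
      (\<lambda>s. E (t - s) (B (u s))) \<psi>"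

text \<open>
  \<open>L\<close> maps \<open>L\<^sup>2(0,T;U)\<close> into \<open>L\<^sup>2(0,T;H)\<close>, linearly and continuously. The function \<open>\<Lambda> u\<close> is a
  representative of \<open>L u\<close>, hence the a.e. equalities.
\<close>

definition response_map_continuous ::
  "'h::complex_hilbert set \<Rightarrow> ('h \<Rightarrow> 'h) \<Rightarrow> (real \<Rightarrow> ('h \<Rightarrow> complex) \<Rightarrow> ('h \<Rightarrow> complex)) \<Rightarrow>
   ('u::complex_hilbert \<Rightarrow> ('h \<Rightarrow> complex)) \<Rightarrow> real \<Rightarrow> bool"
  where "response_map_continuous D A E B T \<longleftrightarrow>
    (\<exists>\<Lambda> :: (real \<Rightarrow> 'u) \<Rightarrow> (real \<Rightarrow> 'h).
      (\<forall>u\<in>L2_on {0..T}. \<Lambda> u \<in> L2_on {0..T} \<and>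
        (AE t in lebesgue_on {0..T}. has_response D A E B u t (incl D A (\<Lambda> u t)))) \<and>
      (\<forall>u\<in>L2_on {0..T}. \<forall>v\<in>L2_on {0..T}.
        AE t in lebesgue_on {0..T}. \<Lambda> (u + v) t = \<Lambda> u t + \<Lambda> v t) \<and>
      (\<forall>c. \<forall>u\<in>L2_on {0..T}. AE t in lebesgue_on {0..T}. \<Lambda> (c *\<^sub>C u) t = c *\<^sub>C \<Lambda> u t) \<and>
      (\<exists>K. \<forall>u\<in>L2_on {0..T}. L2_norm_on {0..T} (\<Lambda> u) \<le> K * L2_norm_on {0..T} u))"

text \<open>\<open>y(t) = e\<^sup>A\<^sup>t y\<^sub>0 + (L u)(t)\<close> for a.e. \<open>t \<ge> 0\<close>, as an identity in \<open>(dom A\<^sup>*)'\<close>.\<close>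

definition is_solution ::
  "'h::complex_hilbert set \<Rightarrow> ('h \<Rightarrow> 'h) \<Rightarrow> (real \<Rightarrow> 'h \<Rightarrow> 'h) \<Rightarrow>
   (real \<Rightarrow> ('h \<Rightarrow> complex) \<Rightarrow> ('h \<Rightarrow> complex)) \<Rightarrow> ('u::complex_hilbert \<Rightarrow> ('h \<Rightarrow> complex)) \<Rightarrow>
   'h \<Rightarrow> (real \<Rightarrow> 'u) \<Rightarrow> (real \<Rightarrow> 'h) \<Rightarrow> bool"
  where "is_solution D A S E B y0 u y \<longleftrightarrow> y \<in> L2_loc \<and>
    (AE t in lebesgue_on {0..}.
      \<exists>\<psi>. has_response D A E B u t \<psi> \<and> incl D A (y t) = incl D A (S t y0) + \<psi>)"

definition supported_in :: "real \<Rightarrow> (real \<Rightarrow> 'a::zero) \<Rightarrow> bool"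
  where "supported_in T f \<longleftrightarrow> (AE t in lebesgue_on {0..}. T < t \<longrightarrow> f t = 0)"

definition steers_to_rest ::
  "'h::complex_hilbert set \<Rightarrow> ('h \<Rightarrow> 'h) \<Rightarrow> (real \<Rightarrow> 'h \<Rightarrow> 'h) \<Rightarrow>
   (real \<Rightarrow> ('h \<Rightarrow> complex) \<Rightarrow> ('h \<Rightarrow> complex)) \<Rightarrow> ('u::complex_hilbert \<Rightarrow> ('h \<Rightarrow> complex)) \<Rightarrow>
   'h \<Rightarrow> (real \<Rightarrow> 'u) \<Rightarrow> real \<Rightarrow> bool"
  where "steers_to_rest D A S E B y0 u T \<longleftrightarrow> u \<in> L2_loc \<and> supported_in T u \<and>
    (\<exists>y. is_solution D A S E B y0 u y \<and> supported_in T y)"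

definition NCVE_element ::
  "'h::complex_hilbert set \<Rightarrow> ('h \<Rightarrow> 'h) \<Rightarrow> (real \<Rightarrow> 'h \<Rightarrow> 'h) \<Rightarrow>
   (real \<Rightarrow> ('h \<Rightarrow> complex) \<Rightarrow> ('h \<Rightarrow> complex)) \<Rightarrow> ('u::complex_hilbert \<Rightarrow> ('h \<Rightarrow> complex)) \<Rightarrow>
   'h \<Rightarrow> bool"
  where "NCVE_element D A S E B y0 \<longleftrightarrow>
    (\<forall>\<epsilon>>0. \<exists>T>0. \<exists>u. steers_to_rest D A S E B y0 u T \<and>
      (\<integral>s. (norm (u s))\<^sup>2 \<partial>lebesgue_on {0..}) \<le> \<epsilon>\<^sup>2)"

definition NCVE ::
  "'h::complex_hilbert set \<Rightarrow> ('h \<Rightarrow> 'h) \<Rightarrow> (real \<Rightarrow> 'h \<Rightarrow> 'h) \<Rightarrow>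
   (real \<Rightarrow> ('h \<Rightarrow> complex) \<Rightarrow> ('h \<Rightarrow> complex)) \<Rightarrow> ('u::complex_hilbert \<Rightarrow> ('h \<Rightarrow> complex)) \<Rightarrow> bool"
  where "NCVE D A S E B \<longleftrightarrow> (\<forall>y0. NCVE_element D A S E B y0)"

end

theory Submission
  imports Defs
begin

text \<open>
  A small circle around \<open>z\<close> lies in the resolvent set and in a half plane \<open>Re \<lambda> \<ge> \<omega> > 0\<close>. The
  integrals \<open>Q\<^sub>s\<close> of \<open>e\<^sup>-\<^sup>\<lambda>\<^sup>s (\<lambda> - A)\<^sup>-\<^sup>1\<close> along it satisfy \<open>e\<^sup>A\<^sup>t Q\<^sub>s\<^sub>+\<^sub>t = Q\<^sub>s\<close> and decay like
  \<open>e\<^sup>-\<^sup>\<omega>\<^sup>s\<close>, together with \<open>A Q\<^sub>s\<close>, and \<open>Q\<^sub>0 \<noteq> 0\<close> because \<open>z\<close> is in the spectrum. Hence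
  \<open>\<eta> s = Q\<^sub>s\<^sup>* x\<close> is a backward orbit of the adjoint semigroup that decays exponentially in
  \<open>dom A\<^sup>*\<close>. If \<open>u\<close> steers \<open>y\<close> to rest, testing the solution at a late time \<open>t\<close> with \<open>\<eta> t\<close>
  gives \<open>\<langle>y, \<eta> 0\<rangle> = - \<integral> \<langle>B u(s), \<eta> s\<rangle> ds\<close>, which is bounded by a constant times the norm of \<open>u\<close>
  in \<open>L\<^sup>2\<close>, uniformly in \<open>t\<close>. If \<open>y\<close> were NCVE then \<open>\<langle>Q\<^sub>0 y, x\<rangle> = \<langle>y, \<eta> 0\<rangle> = 0\<close>, and
  \<open>x = Q\<^sub>0 y \<noteq> 0\<close> is a contradiction.
\<close>

section \<open>Complex Hilbert spaces\<close>

lemma scaleC_one [simp]: "1 *\<^sub>C x = (x::'a::complex_vector)"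
  using scaleR_scaleC[of 1 x] by simp

lemma scaleC_zero_left [simp]: "0 *\<^sub>C x = (0::'a::complex_vector)"
  using scaleR_scaleC[of 0 x] by simp

lemma scaleC_zero_right [simp]: "c *\<^sub>C 0 = (0::'a::complex_vector)"
  using scaleC_add_right[of c 0 "0::'a"] by simp

lemma scaleC_minus_one [simp]: "(-1) *\<^sub>C x = - (x::'a::complex_vector)"
  using scaleR_scaleC[of "-1" x] by simp

lemma scaleC_minus_left: "(- c) *\<^sub>C x = - (c *\<^sub>C (x::'a::complex_vector))"
  using scaleC_scaleC[of "-1" c x] by simp

lemma scaleC_minus_right: "c *\<^sub>C (- x) = - (c *\<^sub>C (x::'a::complex_vector))"
  using scaleC_scaleC[of c "-1" x] scaleC_minus_left[of c x] by simp

lemma scaleC_diff_right: "c *\<^sub>C (x - y) = c *\<^sub>C x - c *\<^sub>C (y::'a::complex_vector)"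
  using scaleC_add_right[of c x "- y"] by (simp add: scaleC_minus_right)

lemma scaleC_diff_left: "(a - b) *\<^sub>C x = a *\<^sub>C x - b *\<^sub>C (x::'a::complex_vector)"
  using scaleC_add_left[of a "- b" x] by (simp add: scaleC_minus_left)

lemma cinner_add_right: "cinner x (y + z) = cinner x y + cinner x z"
  by (metis cinner_add_left cinner_commute complex_cnj_add)

lemma cinner_scaleC_right: "cinner x (c *\<^sub>C y) = cnj c * cinner x y"
  by (metis cinner_commute cinner_scaleC_left complex_cnj_mult)

lemma cinner_zero_left [simp]: "cinner 0 y = 0"
  using cinner_scaleC_left[of 0 0 y] by simp

lemma cinner_zero_right [simp]: "cinner y 0 = 0"
  using cinner_scaleC_right[of y 0 0] by simp

lemma cinner_minus_left: "cinner (- x) y = - cinner x y"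
  using cinner_scaleC_left[of "-1" x y] by simp

lemma cinner_minus_right: "cinner x (- y) = - cinner x y"
  using cinner_scaleC_right[of x "-1" y] by simp

lemma cinner_diff_left: "cinner (x - y) z = cinner x z - cinner y z"
  using cinner_add_left[of x "- y" z] by (simp add: cinner_minus_left)

lemma cinner_diff_right: "cinner x (y - z) = cinner x y - cinner x z"
  using cinner_add_right[of x y "- z"] by (simp add: cinner_minus_right)

lemma cinner_self: "cinner x x = complex_of_real ((norm x)\<^sup>2)"
proof -
  have "Im (cinner x x) = 0"
    using arg_cong[OF cinner_commute[of x x], of Im] by simp
  then show ?thesis
    by (simp add: complex_eq_iff Re_cinner power2_norm_eq_inner)
qed

lemma norm_scaleC [simp]: "norm (c *\<^sub>C x) = cmod c * norm (x::'a::complex_hilbert)"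
proof -
  have "complex_of_real ((norm (c *\<^sub>C x))\<^sup>2) = c * cnj c * complex_of_real ((norm x)\<^sup>2)"
    by (simp only: cinner_self [symmetric] cinner_scaleC_left cinner_scaleC_right mult_ac)
  also have "\<dots> = complex_of_real ((cmod c * norm x)\<^sup>2)"
    by (simp only: complex_norm_square[symmetric] power_mult_distrib of_real_mult of_real_power)
  finally have "(norm (c *\<^sub>C x))\<^sup>2 = (cmod c * norm x)\<^sup>2"
    using of_real_eq_iff by blast
  then show ?thesis
    by (simp add: power2_eq_iff_nonneg)
qed

lemma cmod_cinner_le: "cmod (cinner x y) \<le> norm x * norm (y::'a::complex_hilbert)"
proof (cases "cinner x y = 0")
  case False
  \<comment> \<open>The phase \<open>c\<close> rotates \<open>x\<close> so that the inner product
    becomes real and nonnegative. It then equals its real part, where the real Cauchy-Schwarz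
    inequality applies.\<close>
  define c where "c = cnj (cinner x y) / cmod (cinner x y)"
  have c: "cmod c = 1" using False by (simp add: c_def norm_divide)
  have "cinner (c *\<^sub>C x) y = cmod (cinner x y)"
    using False complex_norm_square[of "cinner x y"]
    by (simp add: cinner_scaleC_left c_def field_simps power2_eq_square)
  then have "cmod (cinner x y) = inner (c *\<^sub>C x) y"
    using Re_cinner[of "c *\<^sub>C x" y] by simp
  also have "\<dots> \<le> norm (c *\<^sub>C x) * norm y" by (rule norm_cauchy_schwarz)
  finally show ?thesis using c by simp
qed simp

lemma bounded_bilinear_scaleC: "bounded_bilinear ((*\<^sub>C) :: complex \<Rightarrow> 'a \<Rightarrow> 'a::complex_hilbert)"
proof
  fix r :: real and a b and x y :: 'a
  show "(a + b) *\<^sub>C x = a *\<^sub>C x + b *\<^sub>C x" "a *\<^sub>C (x + y) = a *\<^sub>C x + a *\<^sub>C y"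
    by (simp_all add: scaleC_add_left scaleC_add_right)
  show "(r *\<^sub>R a) *\<^sub>C x = r *\<^sub>R (a *\<^sub>C x)" "a *\<^sub>C (r *\<^sub>R x) = r *\<^sub>R (a *\<^sub>C x)"
    unfolding scaleR_scaleC[where 'a='a] scaleC_scaleC scaleR_conv_of_real by (simp_all add: mult.commute)
  show "\<exists>K. \<forall>a x. norm (a *\<^sub>C (x::'a)) \<le> norm a * norm x * K"
    by (rule exI[of _ 1]) simp
qed

lemmas continuous_on_scaleC [continuous_intros] =
  bounded_bilinear.continuous_on [OF bounded_bilinear_scaleC]
lemmas tendsto_scaleC [tendsto_intros] = bounded_bilinear.tendsto [OF bounded_bilinear_scaleC]

abbreviation bounded_clinear :: "('a::complex_hilbert \<Rightarrow> 'b::complex_hilbert) \<Rightarrow> bool"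
  where "bounded_clinear \<equiv> bounded_clinear_on UNIV norm UNIV norm"

lemma bounded_clinear_add: "bounded_clinear T \<Longrightarrow> T (x + y) = T x + T y"
  and bounded_clinear_scaleC: "bounded_clinear T \<Longrightarrow> T (c *\<^sub>C x) = c *\<^sub>C T x"
  by (auto simp: bounded_clinear_on_def)

lemma bounded_clinear_bound:
  assumes "bounded_clinear T"
  obtains K where "K > 0" "\<And>x. norm (T x) \<le> K * norm x"
proof -
  obtain K where K: "\<And>x. norm (T x) \<le> K * norm x"
    using assms by (auto simp: bounded_clinear_on_def)
  have "norm (T x) \<le> (\<bar>K\<bar> + 1) * norm x" for x
    using K[of x] by (smt (verit) mult_right_mono norm_ge_zero)
  then show ?thesis using that[of "\<bar>K\<bar> + 1"] by simp
qed

lemma bounded_clinear_bounded_linear: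
  assumes T: "bounded_clinear T"
  shows "bounded_linear T"
proof -
  obtain K where "\<And>x. norm (T x) \<le> K * norm x" using bounded_clinear_bound[OF T] by blast
  then show ?thesis
    by (intro bounded_linear_intro[of T K])
       (simp_all add: scaleR_scaleC bounded_clinear_add[OF T] bounded_clinear_scaleC[OF T] mult.commute)
qed

text \<open>The Riesz representer is the normalised minimiser of the norm on \<open>{x. f x = 1}\<close>.\<close>

lemma Riesz_representation:
  fixes f :: "'a::{real_inner,banach} \<Rightarrow> real"
  assumes "bounded_linear f"
  obtains a where "\<And>x. f x = inner a x"
proof (cases "\<forall>x. f x = 0")
  case True
  then show ?thesis using that[of 0] by simp
next
  case False
  interpret f: bounded_linear f by fact
  define V where "V = {x. f x = 1}"
  define d where "d = (INF x\<in>V. (norm x)\<^sup>2)"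
  from False obtain w where w: "f w \<noteq> 0" by blast
  have "w /\<^sub>R f w \<in> V" using w by (simp add: V_def f.scaleR)
  then have ne: "V \<noteq> {}" by blast
  have bdd: "bdd_below ((\<lambda>x. (norm x)\<^sup>2) ` V)"
    by (rule bdd_belowI[of _ 0]) auto
  have lower: "d \<le> (norm x)\<^sup>2" if "x \<in> V" for x
    unfolding d_def using bdd that by (rule cINF_lower)
  have "\<exists>x\<in>V. (norm x)\<^sup>2 < d + 1 / Suc n" for n
  proof -
    have "d < d + 1 / Suc n" by simp
    then show ?thesis unfolding d_def using cINF_less_iff[OF ne bdd] by blast
  qed
  then obtain X where X: "\<And>n. X n \<in> V" "\<And>n. (norm (X n))\<^sup>2 < d + 1 / Suc n"
    by metis
  \<comment> \<open>The midpoint of two points of \<open>V\<close> lies in \<open>V\<close>, so its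
    squared norm is at least \<open>d\<close>. The parallelogram law then forces near-minimisers to
    be close to each other.\<close>
  have close: "(norm (x - y))\<^sup>2 \<le> 2 * (p + q)"
    if "x \<in> V" "y \<in> V" "(norm x)\<^sup>2 < d + p" "(norm y)\<^sup>2 < d + q" for x y p q
  proof -
    have "(1/2) *\<^sub>R (x + y) \<in> V"
      using that by (simp add: V_def f.scaleR f.add)
    then have "4 * d \<le> (norm (x + y))\<^sup>2"
      using lower by (fastforce simp: power_mult_distrib power2_eq_square)
    moreover have "(norm (x + y))\<^sup>2 + (norm (x - y))\<^sup>2 = 2 * (norm x)\<^sup>2 + 2 * (norm y)\<^sup>2"
      by (simp add: power2_norm_eq_inner inner_add_left inner_add_right inner_diff_left inner_diff_right)
    ultimately show ?thesis using that by simp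
  qed
  have "Cauchy X"
  proof (rule metric_CauchyI)
    fix e :: real assume e: "e > 0"
    \<comment> \<open>By \<open>close\<close> the squared distance of \<open>X m\<close> and
      \<open>X n\<close> is at most 2 (1/(m+1) + 1/(n+1)), hence at most 4/(M+1).\<close>
    obtain M where M: "4 / real (Suc M) < e\<^sup>2"
      using reals_Archimedean[of "e\<^sup>2 / 4"] e by (auto simp: field_simps)
    have "dist (X m) (X n) < e" if "m \<ge> M" "n \<ge> M" for m n
    proof -
      have "1 / real (Suc m) \<le> 1 / real (Suc M)" "1 / real (Suc n) \<le> 1 / real (Suc M)"
        using that by (auto simp: frac_le)
      then have "(norm (X m - X n))\<^sup>2 < e\<^sup>2"
        using close[OF X(1) X(1) X(2) X(2), of m n] M by simp
      then show ?thesis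
        using e by (simp add: dist_norm power2_less_imp_less)
    qed
    then show "\<exists>M. \<forall>m\<ge>M. \<forall>n\<ge>M. dist (X m) (X n) < e" by blast
  qed
  then obtain v where v: "X \<longlonglongrightarrow> v"
    using Cauchy_convergent_iff convergent_def by blast
  have "(\<lambda>n. f (X n)) \<longlonglongrightarrow> f v" by (rule f.tendsto[OF v])
  then have fv: "f v = 1"
    using X(1) by (simp add: V_def LIMSEQ_const_iff)
  have vd: "(norm v)\<^sup>2 \<le> d"
  proof (rule LIMSEQ_le)
    show "(\<lambda>n. (norm (X n))\<^sup>2) \<longlonglongrightarrow> (norm v)\<^sup>2" by (intro tendsto_intros v)
    have "(\<lambda>n. 1 / real (Suc n)) \<longlonglongrightarrow> 0"
      using LIMSEQ_inverse_real_of_nat by (simp add: inverse_eq_divide)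
    from tendsto_add[OF tendsto_const[of d] this]
    show "(\<lambda>n. d + 1 / real (Suc n)) \<longlonglongrightarrow> d" by simp
    show "\<exists>N. \<forall>n\<ge>N. (norm (X n))\<^sup>2 \<le> d + 1 / real (Suc n)"
      using X(2) less_imp_le by blast
  qed
  have orth: "inner v x = 0" if x: "f x = 0" for x
  proof (cases "x = 0")
    case False
    \<comment> \<open>This \<open>t\<close> minimises the norm along the line
      \<open>v - t *\<^sub>R x\<close>, which stays in \<open>V\<close>; minimality of
      \<open>v\<close> leaves no component along \<open>x\<close>.\<close>
    define t where "t = inner v x / (norm x)\<^sup>2"
    have "v - t *\<^sub>R x \<in> V" using fv x by (simp add: V_def f.diff f.scaleR)
    then have "(norm v)\<^sup>2 \<le> (norm (v - t *\<^sub>R x))\<^sup>2"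
      using lower vd order_trans by blast
    also have "\<dots> = (norm v)\<^sup>2 - 2 * t * inner v x + t\<^sup>2 * (norm x)\<^sup>2"
      unfolding power2_norm_eq_inner
      by (simp add: inner_diff_left inner_diff_right inner_commute[of x v] power2_eq_square algebra_simps)
    also have "\<dots> = (norm v)\<^sup>2 - (inner v x)\<^sup>2 / (norm x)\<^sup>2"
      using False by (simp add: t_def field_simps power2_eq_square)
    finally have "(inner v x)\<^sup>2 / (norm x)\<^sup>2 \<le> 0" by simp
    then show ?thesis using False by (simp add: divide_le_0_iff)
  qed simp
  have "v \<noteq> 0" using fv f.zero by auto
  have "f x = inner (v /\<^sub>R (norm v)\<^sup>2) x" for x
  proof -
    have "inner v (x - f x *\<^sub>R v) = 0"
      using fv by (intro orth) (simp add: f.diff f.scaleR)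
    then have "inner v x = f x * (norm v)\<^sup>2"
      by (simp add: inner_diff_right power2_norm_eq_inner)
    then show ?thesis using \<open>v \<noteq> 0\<close> by simp
  qed
  then show ?thesis using that by blast
qed

text \<open>The real part of \<open>g\<close> falls under the real theorem. The imaginary part
  follows by evaluation at \<open>\<i> *\<^sub>C x\<close>, because antilinearity turns Re (g (i x))
  into Im (g x).\<close>

lemma Riesz_antilinear:
  fixes g :: "'a::complex_hilbert \<Rightarrow> complex"
  assumes add: "\<And>x y. g (x + y) = g x + g y"
    and scale: "\<And>c x. g (c *\<^sub>C x) = cnj c * g x"
    and bound: "\<And>x. cmod (g x) \<le> K * norm x"
  obtains h where "\<And>x. g x = cinner h x"
proof -
  have "bounded_linear (\<lambda>x. Re (g x))"
  proof (rule bounded_linear_intro)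
    fix x show "norm (Re (g x)) \<le> norm x * K"
      using abs_Re_le_cmod[of "g x"] bound[of x] by (simp add: mult.commute)
  qed (simp_all add: add scaleR_scaleC scale)
  then obtain h where h: "\<And>x. Re (g x) = inner h x" by (rule Riesz_representation) blast
  have "g x = cinner h x" for x
  proof (rule complex_eqI)
    show "Re (g x) = Re (cinner h x)" using h by (simp add: Re_cinner)
    have "Re (g (\<i> *\<^sub>C x)) = Re (cinner h (\<i> *\<^sub>C x))" using h by (simp add: Re_cinner)
    then show "Im (g x) = Im (cinner h x)" by (simp add: scale cinner_scaleC_right)
  qed
  then show ?thesis using that by blast
qed

text \<open>The vector \<open>a\<close> is the Riesz representer of \<open>cinner x (T y)\<close> as
  an antilinear functional of \<open>y\<close>; testing with \<open>y = a\<close> yields the norm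
  bound.\<close>

lemma bounded_adjoint_exists:
  fixes T :: "'a::complex_hilbert \<Rightarrow> 'b::complex_hilbert"
  assumes T: "bounded_clinear T" and K: "\<And>y. norm (T y) \<le> K * norm y" and "K \<ge> 0"
  obtains a where "\<And>y. cinner (T y) x = cinner y a" "norm a \<le> K * norm x"
proof -
  obtain a where a: "\<And>y. cinner x (T y) = cinner a y"
  proof (rule Riesz_antilinear)
    fix y show "cmod (cinner x (T y)) \<le> (norm x * K) * norm y"
      by (metis K cmod_cinner_le mult.assoc mult_left_mono norm_ge_zero order_trans)
  qed (simp_all add: bounded_clinear_add[OF T] bounded_clinear_scaleC[OF T] cinner_add_right cinner_scaleC_right)
  have *: "cinner (T y) x = cinner y a" for y
    using a[of y] by (metis cinner_commute)
  have "norm a * norm a = cmod (cinner (T a) x)"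
    by (simp add: * cinner_self power2_eq_square norm_mult)
  also have "\<dots> \<le> norm (T a) * norm x" by (rule cmod_cinner_le)
  also have "\<dots> \<le> (K * norm a) * norm x" by (intro mult_right_mono K) simp
  finally have "norm a * norm a \<le> (K * norm x) * norm a" by (simp add: mult_ac)
  then have "norm a \<le> K * norm x"
    using \<open>K \<ge> 0\<close> by (cases "a = 0") simp_all
  then show ?thesis using that * by blast
qed

text \<open>The closed sets \<open>F n\<close> cover the Banach space, so by Baire's theorem one of
  them contains a ball, and a bound on a ball controls a linear map in every direction.\<close>

lemma uniform_boundedness:
  fixes T :: "'i \<Rightarrow> 'a::banach \<Rightarrow> 'b::real_normed_vector"
  assumes lin: "\<And>i. i \<in> I \<Longrightarrow> bounded_linear (T i)"
    and pw: "\<And>x. \<exists>C. \<forall>i\<in>I. norm (T i x) \<le> C"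
  obtains K where "K > 0" "\<And>i x. i \<in> I \<Longrightarrow> norm (T i x) \<le> K * norm x"
proof -
  define F where "F n = {x. \<forall>i\<in>I. norm (T i x) \<le> real n}" for n :: nat
  have F_eq: "F n = (\<Inter>i\<in>I. {x. norm (T i x) \<le> real n})" for n
    by (auto simp: F_def)
  have closed: "closed (F n)" for n
    unfolding F_eq using lin
    by (intro closed_INT ballI closed_Collect_le continuous_intros
        bounded_linear.continuous_on[OF lin]) auto
  have cover: "(\<Union>n. F n) = UNIV"
  proof -
    have "\<exists>n. x \<in> F n" for x
    proof -
      obtain C where "\<forall>i\<in>I. norm (T i x) \<le> C" using pw by blast
      moreover obtain n where "C \<le> real n" using real_arch_simple by blast
      ultimately have "x \<in> F n" by (auto simp: F_def intro: order_trans)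
      then show ?thesis ..
    qed
    then show ?thesis by blast
  qed
  have "\<exists>n. interior (F n) \<noteq> {}"
  proof (rule ccontr)
    assume no: "\<not> ?thesis"
    have "euclidean interior_of \<Union>(range F) = {}"
    proof (rule Met_TC.metric_Baire_category_alt[unfolded mtopology_is_euclidean])
      show "Met_TC.mcomplete (TYPE('a))"
        by (simp add: complete_UNIV mcomplete_iff_complete)
    qed (use closed no in auto)
    then show False using cover by simp
  qed
  then obtain n x0 where "x0 \<in> interior (F n)" by blast
  then obtain r where r: "r > 0" "cball x0 r \<subseteq> F n"
    by (meson mem_interior_cball)
  \<comment> \<open>A vector scaled to length \<open>r\<close> is a difference of two points of the
    ball, at each of which \<open>T i\<close> is bounded by \<open>n\<close>; this gives 2 n / r.
    The extra 1 keeps the constant positive when \<open>n\<close> is 0.\<close>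
  have "norm (T i x) \<le> ((2 * real n + 1) / r) * norm x" if i: "i \<in> I" for i x
  proof (cases "x = 0")
    case True
    then show ?thesis using linear_simps(3)[OF lin[OF i]] by simp
  next
    case False
    interpret bounded_linear "T i" by (rule lin[OF i])
    let ?y = "(r / norm x) *\<^sub>R x"
    have "x0 + ?y \<in> F n" "x0 \<in> F n"
      using r False by (auto intro!: subsetD[OF r(2)] simp: dist_norm)
    then have b: "norm (T i (x0 + ?y)) \<le> n" "norm (T i x0) \<le> n" using i by (auto simp: F_def)
    have "T i ?y = T i (x0 + ?y) - T i x0" by (simp add: add)
    then have "norm (T i ?y) \<le> 2 * real n + 1"
      using norm_triangle_ineq4[of "T i (x0 + ?y)" "T i x0"] b by simp
    moreover have "norm (T i ?y) = r / norm x * norm (T i x)"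
      using r by (simp add: scaleR)
    ultimately show ?thesis using False r by (simp add: field_simps)
  qed
  then show ?thesis using that[of "(2 * real n + 1) / r"] r by (simp add: add_nonneg_pos)
qed

section \<open>Semigroups and the resolvent of the generator\<close>

lemma has_vector_derivative_imp_quotient:
  assumes "(v has_vector_derivative d) (at t)"
  shows "((\<lambda>k. (v (t + k) - v t) /\<^sub>R k) \<longlongrightarrow> d) (at 0)"
proof -
  have "((\<lambda>k. norm (v (t + k) - v t - k *\<^sub>R d) / norm k) \<longlongrightarrow> 0) (at 0)"
    using assms by (simp add: has_vector_derivative_def has_derivative_at)
  then have "((\<lambda>k. norm ((v (t + k) - v t) /\<^sub>R k - d)) \<longlongrightarrow> 0) (at 0)"
  proof (rule Lim_transform_eventually)
    show "\<forall>\<^sub>F k in at 0. norm (v (t + k) - v t - k *\<^sub>R d) / norm k = norm ((v (t + k) - v t) /\<^sub>R k - d)"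
    proof (rule eventually_at_ball'[of 1, THEN eventually_mono], simp, safe)
      fix k :: real assume "k \<noteq> 0"
      then have "(v (t + k) - v t) /\<^sub>R k - d = (v (t + k) - v t - k *\<^sub>R d) /\<^sub>R k"
        by (simp add: scaleR_diff_right)
      then show "norm (v (t + k) - v t - k *\<^sub>R d) / norm k = norm ((v (t + k) - v t) /\<^sub>R k - d)"
        by (simp add: divide_inverse mult.commute)
    qed
  qed
  then show ?thesis
    using tendsto_norm_zero_iff LIM_zero_iff by blast
qed

locale semigroup_generator =
  fixes D :: "'h::complex_hilbert set" and A :: "'h \<Rightarrow> 'h" and S :: "real \<Rightarrow> 'h \<Rightarrow> 'h"
  assumes generates: "generates_C0_semigroup_on UNIV norm (op_graph D A) S"
begin

lemma S_bounded: "t \<ge> 0 \<Longrightarrow> bounded_clinear (S t)"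
  and S_0: "S 0 x = x"
  and S_add: "s \<ge> 0 \<Longrightarrow> t \<ge> 0 \<Longrightarrow> S (s + t) x = S s (S t x)"
  using generates by (auto simp: generates_C0_semigroup_on_def C0_semigroup_on_def)

lemma S_tendsto: "((\<lambda>t. S t x) \<longlongrightarrow> x) (at_right 0)"
proof -
  have "((\<lambda>t. norm (S t x - x)) \<longlongrightarrow> 0) (at_right 0)"
    using generates by (auto simp: generates_C0_semigroup_on_def C0_semigroup_on_def)
  then show ?thesis using tendsto_norm_zero_iff LIM_zero_iff by blast
qed

lemmas S_linear = bounded_clinear_bounded_linear[OF S_bounded]

text \<open>One limit decides both membership in \<open>D\<close> and the value of \<open>A\<close>,
  so closure properties of the domain reduce to limits of difference quotients.\<close>

lemma generator_iff:
  "x \<in> D \<and> A x = y \<longleftrightarrow> ((\<lambda>t. (S t x - x) /\<^sub>R t) \<longlongrightarrow> y) (at_right 0)"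
proof -
  have "x \<in> D \<and> A x = y \<longleftrightarrow> (x, y) \<in> generator_on UNIV norm S"
    using generates by (auto simp: generates_C0_semigroup_on_def op_graph_def)
  also have "\<dots> \<longleftrightarrow> ((\<lambda>t. (S t x - x) /\<^sub>R t) \<longlongrightarrow> y) (at_right 0)"
    unfolding generator_on_def by (simp add: tendsto_norm_zero_iff LIM_zero_iff)
  finally show ?thesis .
qed

lemma generator_tendsto: "x \<in> D \<Longrightarrow> ((\<lambda>t. (S t x - x) /\<^sub>R t) \<longlongrightarrow> A x) (at_right 0)"
  using generator_iff by blast

lemma eventually_at_right_0: "\<forall>\<^sub>F t :: real in at_right 0. 0 < t"
  by (simp add: eventually_at_filter)

lemma D_add: "x \<in> D \<Longrightarrow> y \<in> D \<Longrightarrow> x + y \<in> D \<and> A (x + y) = A x + A y"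
proof (unfold generator_iff)
  assume "x \<in> D" "y \<in> D"
  from tendsto_add[OF generator_tendsto[OF this(1)] generator_tendsto[OF this(2)]]
  show "((\<lambda>t. (S t (x + y) - (x + y)) /\<^sub>R t) \<longlongrightarrow> A x + A y) (at_right 0)"
    by (rule Lim_transform_eventually)
       (use eventually_at_right_0 in \<open>eventually_elim,
          simp add: bounded_clinear_add[OF S_bounded] flip: scaleR_add_right\<close>)
qed

lemma D_scaleC: "x \<in> D \<Longrightarrow> c *\<^sub>C x \<in> D \<and> A (c *\<^sub>C x) = c *\<^sub>C A x"
proof (unfold generator_iff)
  assume "x \<in> D"
  from tendsto_scaleC[OF tendsto_const generator_tendsto[OF this], of c]
  show "((\<lambda>t. (S t (c *\<^sub>C x) - c *\<^sub>C x) /\<^sub>R t) \<longlongrightarrow> c *\<^sub>C A x) (at_right 0)"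
    by (rule Lim_transform_eventually)
       (use eventually_at_right_0 in \<open>eventually_elim,
          simp add: bounded_clinear_scaleC[OF S_bounded] scaleR_scaleC scaleC_scaleC mult.commute
            flip: scaleC_diff_right\<close>)
qed

lemma D_diff: "x \<in> D \<Longrightarrow> y \<in> D \<Longrightarrow> x - y \<in> D \<and> A (x - y) = A x - A y"
  using D_add[of x "(-1) *\<^sub>C y"] D_scaleC[of y "-1"] by simp

lemma S_invariant:
  assumes t: "t \<ge> 0" and x: "x \<in> D"
  shows "S t x \<in> D \<and> A (S t x) = S t (A x)"
proof (unfold generator_iff)
  interpret T: bounded_linear "S t" by (rule S_linear[OF t])
  from T.tendsto[OF generator_tendsto[OF x]]
  show "((\<lambda>k. (S k (S t x) - S t x) /\<^sub>R k) \<longlongrightarrow> S t (A x)) (at_right 0)"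
  proof (rule Lim_transform_eventually)
    show "\<forall>\<^sub>F k in at_right 0. S t ((S k x - x) /\<^sub>R k) = (S k (S t x) - S t x) /\<^sub>R k"
      using eventually_at_right_0
    proof eventually_elim
      case (elim k)
      have "S t (S k x) = S k (S t x)"
        using S_add[of t k x] S_add[of k t x] elim t by (simp add: add.commute)
      then show ?case by (simp add: T.scaleR T.diff)
    qed
  qed
qed

text \<open>Otherwise there were times \<open>X n \<rightarrow> 0\<close> at which the norms of \<open>S (X n)\<close> are unbounded, although
  \<open>S (X n) x \<rightarrow> x\<close> for all \<open>x\<close>.\<close>

lemma S_locally_bounded:
  obtains \<delta> M where "\<delta> > 0" "M > 0" "\<And>t x. 0 \<le> t \<Longrightarrow> t \<le> \<delta> \<Longrightarrow> norm (S t x) \<le> M * norm x"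
proof (rule ccontr)
  assume none: "\<not> thesis"
  \<comment> \<open>If no constants work, then in particular the pair 1/(n+1), n+1 fails for every
    \<open>n\<close>.\<close>
  have "\<exists>t x. 0 \<le> t \<and> t \<le> 1 / Suc n \<and> norm (S t x) > real (Suc n) * norm x" for n
  proof (rule ccontr)
    assume "\<not> ?thesis"
    then have "\<And>t x. 0 \<le> t \<Longrightarrow> t \<le> 1 / Suc n \<Longrightarrow> norm (S t x) \<le> real (Suc n) * norm x"
      by (meson not_le)
    then show False using none that[of "1 / Suc n" "Suc n"] by simp
  qed
  then obtain X Y where X: "\<And>n. 0 \<le> X n" "\<And>n. X n \<le> 1 / Suc n"
    and Y: "\<And>n. norm (S (X n) (Y n)) > real (Suc n) * norm (Y n)"
    by metis
  have X0: "X \<longlonglongrightarrow> 0"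
  proof (rule tendsto_sandwich[OF _ _ tendsto_const])
    show "(\<lambda>n. 1 / real (Suc n)) \<longlonglongrightarrow> 0"
      using LIMSEQ_inverse_real_of_nat by (simp add: inverse_eq_divide)
  qed (use X in auto)
  have conv: "(\<lambda>n. S (X n) x) \<longlonglongrightarrow> x" for x
  proof -
    have "((\<lambda>t. S t x) \<longlongrightarrow> S 0 x) (at 0 within {0..})"
      using S_tendsto[of x] by (simp add: at_within_Ici_at_right S_0)
    then have "continuous (at 0 within {0..}) (\<lambda>t. S t x)"
      by (simp add: continuous_within)
    then have "(\<lambda>n. S (X n) x) \<longlonglongrightarrow> S 0 x"
      by (rule continuous_within_tendsto_compose') (use X X0 in auto)
    then show ?thesis by (simp add: S_0)
  qed
  have pw: "\<exists>C. \<forall>n\<in>UNIV. norm (S (X n) x) \<le> C" for x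
    using convergent_imp_Bseq[OF convergentI[OF conv[of x]]] by (auto simp: Bseq_def)
  obtain K where K: "\<And>n x. norm (S (X n) x) \<le> K * norm x"
    using uniform_boundedness[OF S_linear[OF X(1)] pw] by (metis UNIV_I)
  obtain n :: nat where n: "K \<le> n" using real_arch_simple by blast
  have "norm (S (X n) (Y n)) \<le> real (Suc n) * norm (Y n)"
    using n by (intro order_trans[OF K] mult_right_mono) auto
  then show False using Y[of n] by simp
qed

text \<open>Strong continuity at 0 alone does not allow a moving argument; the uniform bound near 0
  absorbs the error \<open>f t - y\<close>.\<close>

lemma S_tendsto_compose:
  assumes "(f \<longlongrightarrow> y) (at_right 0)"
  shows "((\<lambda>t. S t (f t)) \<longlongrightarrow> y) (at_right 0)"
proof -
  obtain \<delta> M where M: "\<delta> > 0" "\<And>t x. 0 \<le> t \<Longrightarrow> t \<le> \<delta> \<Longrightarrow> norm (S t x) \<le> M * norm x"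
    using S_locally_bounded by metis
  have "((\<lambda>t. S t (f t - y)) \<longlongrightarrow> 0) (at_right 0)"
  proof (rule Lim_null_comparison)
    show "((\<lambda>t. M * norm (f t - y)) \<longlongrightarrow> 0) (at_right 0)"
      using assms by (intro tendsto_eq_intros refl tendsto_norm_zero LIM_zero) auto
    show "\<forall>\<^sub>F t in at_right 0. norm (S t (f t - y)) \<le> M * norm (f t - y)"
      unfolding eventually_at_right_field using M by (intro exI[of _ \<delta>]) auto
  qed
  from tendsto_add[OF this S_tendsto[of y]]
  have "((\<lambda>t. S t (f t - y) + S t y) \<longlongrightarrow> y) (at_right 0)" by simp
  then show ?thesis
    by (rule Lim_transform_eventually)
       (use eventually_at_right_0 in \<open>eventually_elim, simp flip: bounded_clinear_add[OF S_bounded]\<close>)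
qed

text \<open>The derivative of \<open>S t (v t)\<close> vanishes. The left derivative needs the local boundedness of \<open>S\<close>.\<close>

lemma S_backward_orbit:
  assumes v: "\<And>t. v t \<in> D" and dv: "\<And>t. (v has_vector_derivative - A (v t)) (at t)"
    and t: "t \<ge> 0"
  shows "S t (v t) = v 0"
proof -
  let ?G = "\<lambda>t. S t (v t)"
  have filter_pos: "filterlim (\<lambda>k. k :: real) (at 0) (at_right 0)"
    by (simp add: filterlim_def at_le)
  have filter_neg: "filterlim (\<lambda>k. - k :: real) (at 0) (at_right 0)"
    unfolding filterlim_at using eventually_at_right_0
    by (auto intro!: tendsto_eq_intros elim: eventually_mono)
  have right: "((\<lambda>k. (?G (s + k) - ?G s) /\<^sub>R k) \<longlongrightarrow> 0) (at_right 0)" if s: "s \<ge> 0" for s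
  proof -
    interpret T: bounded_linear "S s" by (rule S_linear[OF s])
    \<comment> \<open>Product rule: with \<open>S s\<close> factored out, the increment splits into
      the motion of \<open>v\<close> seen through \<open>S k\<close> and the motion of
      \<open>S k\<close> at \<open>v s\<close>. The limits \<open>- A (v s)\<close> and
      \<open>A (v s)\<close> cancel.\<close>
    have "((\<lambda>k. S k ((v (s + k) - v s) /\<^sub>R k)) \<longlongrightarrow> - A (v s)) (at_right 0)"
      by (intro S_tendsto_compose
          filterlim_compose[OF has_vector_derivative_imp_quotient[OF dv] filter_pos])
    from T.tendsto[OF tendsto_add[OF this generator_tendsto[OF v[of s]]]]
    have "((\<lambda>k. S s (S k ((v (s + k) - v s) /\<^sub>R k) + (S k (v s) - v s) /\<^sub>R k)) \<longlongrightarrow> 0) (at_right 0)"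
      by (simp add: T.zero)
    then show ?thesis
    proof (rule Lim_transform_eventually)
      show "\<forall>\<^sub>F k in at_right 0. S s (S k ((v (s + k) - v s) /\<^sub>R k) + (S k (v s) - v s) /\<^sub>R k)
        = (?G (s + k) - ?G s) /\<^sub>R k"
        using eventually_at_right_0
      proof eventually_elim
        case (elim k)
        interpret K: bounded_linear "S k" using elim by (intro S_linear) simp
        show ?case using elim s
          by (simp add: S_add K.scaleR K.diff T.scaleR T.diff T.add flip: scaleR_add_right)
      qed
    qed
  qed
  have left: "((\<lambda>k. (?G (s - k) - ?G s) /\<^sub>R k) \<longlongrightarrow> 0) (at_right 0)" if s: "s > 0" for s
  proof -
    obtain \<delta> M where M: "\<delta> > 0" "M > 0" "\<And>t x. 0 \<le> t \<Longrightarrow> t \<le> \<delta> \<Longrightarrow> norm (S t x) \<le> M * norm x"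
      using S_locally_bounded by metis
    \<comment> \<open>For \<open>0 < k < \<delta>'\<close> the operator \<open>S (s - k)\<close>
      factors as the fixed \<open>S (s - \<delta>')\<close> after \<open>S (\<delta>' - k)\<close>,
      whose time lies in the range of the local bound. This bounds \<open>S (s - k)\<close>
      uniformly in \<open>k\<close>.\<close>
    define \<delta>' where "\<delta>' = min \<delta> s"
    have \<delta>': "0 < \<delta>'" "\<delta>' \<le> \<delta>" "\<delta>' \<le> s" using M s by (auto simp: \<delta>'_def)
    obtain C where C: "C > 0" "\<And>x. norm (S (s - \<delta>') x) \<le> C * norm x"
      using bounded_clinear_bound[OF S_bounded[of "s - \<delta>'"]] \<delta>' by auto
    have SC: "norm (S (s - k) x) \<le> C * (M * norm x)" if "0 < k" "k < \<delta>'" for k x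
    proof -
      have "S (s - k) x = S (s - \<delta>') (S (\<delta>' - k) x)"
        using S_add[of "s - \<delta>'" "\<delta>' - k" x] that \<delta>' by simp
      then have "norm (S (s - k) x) \<le> C * norm (S (\<delta>' - k) x)" using C by simp
      also have "\<dots> \<le> C * (M * norm x)" using M(3)[of "\<delta>' - k" x] C that \<delta>' by simp
      finally show ?thesis .
    qed
    \<comment> \<open>\<open>?w k\<close> is the left quotient with \<open>S (s - k)\<close>
      factored out. It is a sum of two quotients with cancelling limits, so boundedness of
      \<open>S (s - k)\<close> suffices.\<close>
    let ?w = "\<lambda>k. - ((v (s + - k) - v s) /\<^sub>R - k) - (S k (v s) - v s) /\<^sub>R k"
    have "(?w \<longlongrightarrow> - (- A (v s)) - A (v s)) (at_right 0)"
      by (intro tendsto_intros generator_tendsto v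
          filterlim_compose[OF has_vector_derivative_imp_quotient[OF dv] filter_neg])
    then have "(?w \<longlongrightarrow> 0) (at_right 0)" by simp
    then have lim: "((\<lambda>k. C * (M * norm (?w k))) \<longlongrightarrow> 0) (at_right 0)"
      by (intro tendsto_mult_right_zero tendsto_norm_zero)
    show ?thesis
    proof (rule Lim_null_comparison[OF _ lim])
      have "norm ((?G (s - k) - ?G s) /\<^sub>R k) \<le> C * (M * norm (?w k))" if k: "0 < k" "k < \<delta>'" for k
      proof -
        interpret K: bounded_linear "S (s - k)" using k \<delta>' by (intro S_linear) simp
        have "S s (v s) = S (s - k) (S k (v s))"
          using S_add[of "s - k" k] k \<delta>' by simp
        then have "(?G (s - k) - ?G s) /\<^sub>R k = S (s - k) (?w k)"
          by (simp add: K.scaleR K.diff K.add flip: scaleR_add_right scaleR_diff_right)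
        then show ?thesis using SC[OF k] by simp
      qed
      then show "\<forall>\<^sub>F k in at_right 0. norm ((?G (s - k) - ?G s) /\<^sub>R k) \<le> C * (M * norm (?w k))"
        unfolding eventually_at_right_field using \<delta>' by (intro exI[of _ \<delta>']) auto
    qed
  qed
  have "(?G has_vector_derivative 0) (at s within {0..})" if s: "s \<in> {0..}" for s
  proof -
    \<comment> \<open>The quotient has the norm in the denominator, as in
      \<open>has_derivative_within\<close>. On the left side this only changes the sign, which the
      limit 0 does not see.\<close>
    let ?q = "\<lambda>y. (1 / norm (y - s)) *\<^sub>R (?G y - ?G s)"
    have "((\<lambda>k. ?q (k + s)) \<longlongrightarrow> 0) (at_right 0)"
      by (rule Lim_transform_eventually[OF right[of s]])
         (use s in \<open>auto intro: eventually_mono[OF eventually_at_right_0] simp: add.commute inverse_eq_divide\<close>)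
    then have r: "(?q \<longlongrightarrow> 0) (at_right s)"
      by (simp only: filterlim_at_right_to_0[of _ _ s])
    have l: "(?q \<longlongrightarrow> 0) (at_left s)" if "s > 0"
    proof -
      have "((\<lambda>k. ?q (- (k + - s))) \<longlongrightarrow> 0) (at_right 0)"
        by (rule Lim_transform_eventually[OF left[OF that]])
           (auto intro: eventually_mono[OF eventually_at_right_0] simp: inverse_eq_divide)
      then show ?thesis
        by (simp only: filterlim_at_left_to_right[of _ _ s] filterlim_at_right_to_0[of _ _ "- s"])
    qed
    have "(?q \<longlongrightarrow> 0) (at s within {0..})"
    proof (cases "s = 0")
      case True
      then show ?thesis using r by (simp add: at_within_Ici_at_right)
    next
      case False
      then have "at s within {0..} = at s" using s by (intro at_within_interior) simp
      then show ?thesis using l r False s by (simp add: filterlim_split_at)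
    qed
    then show ?thesis
      by (simp add: has_vector_derivative_def has_derivative_within)
  qed
  then obtain c where "\<And>s. s \<in> {0..} \<Longrightarrow> ?G s = c"
    using has_vector_derivative_zero_constant[of "{0..}" ?G] by auto
  then show ?thesis using t S_0 by (metis atLeast_iff order_refl)
qed

section \<open>The resolvent of the generator\<close>

definition R :: "complex \<Rightarrow> 'h \<Rightarrow> 'h"
  where "R l = inv_into D (\<lambda>x. l *\<^sub>C x - A x)"

abbreviation "\<rho> \<equiv> resolvent_set D A"

lemma R_bounded: "l \<in> \<rho> \<Longrightarrow> bounded_clinear (R l)"
  by (simp add: resolvent_set_def R_def)

lemmas R_linear = bounded_clinear_bounded_linear[OF R_bounded]

lemma R_in_D: "l \<in> \<rho> \<Longrightarrow> R l h \<in> D"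
  by (auto simp: resolvent_set_def R_def bij_betw_def intro!: inv_into_into)

lemma R_right: "l \<in> \<rho> \<Longrightarrow> l *\<^sub>C R l h - A (R l h) = h"
  unfolding R_def using f_inv_into_f[of h "\<lambda>x. l *\<^sub>C x - A x" D]
  by (auto simp: resolvent_set_def bij_betw_def)

lemma A_R: "l \<in> \<rho> \<Longrightarrow> A (R l h) = l *\<^sub>C R l h - h"
  using R_right[of l h] by (simp add: algebra_simps)

lemma R_left: "l \<in> \<rho> \<Longrightarrow> x \<in> D \<Longrightarrow> R l (l *\<^sub>C x - A x) = x"
  by (auto simp: resolvent_set_def R_def bij_betw_def intro: inv_into_f_f)

lemma R_A: "l \<in> \<rho> \<Longrightarrow> x \<in> D \<Longrightarrow> R l (A x) = A (R l x)"
proof -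
  assume l: "l \<in> \<rho>" and x: "x \<in> D"
  interpret bounded_linear "R l" by (rule R_linear[OF l])
  show ?thesis using R_left[OF l x] A_R[OF l, of x]
    by (simp add: diff bounded_clinear_scaleC[OF R_bounded[OF l]] algebra_simps)
qed

lemma resolvent_identity:
  assumes l: "l \<in> \<rho>" and m: "m \<in> \<rho>"
  shows "R l h - R m h = (m - l) *\<^sub>C R m (R l h)"
proof -
  interpret bounded_linear "R m" by (rule R_linear[OF m])
  have "m *\<^sub>C R l h - A (R l h) = (m - l) *\<^sub>C R l h + h"
    by (simp add: A_R[OF l] scaleC_diff_left)
  then have "R l h = R m ((m - l) *\<^sub>C R l h + h)"
    using R_left[OF m R_in_D[OF l], of h] by simp
  then show ?thesis
    by (simp add: add bounded_clinear_scaleC[OF R_bounded[OF m]] algebra_simps)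
qed

lemma continuous_on_R: "continuous_on \<rho> (\<lambda>l. R l h)"
proof (unfold continuous_on_def, intro ballI)
  fix m assume m: "m \<in> \<rho>"
  obtain M where M: "M > 0" "\<And>x. norm (R m x) \<le> M * norm x"
    using bounded_clinear_bound[OF R_bounded[OF m]] by auto
  \<comment> \<open>Within distance 1/(2M) the resolvent identity bounds the difference by half the
    norm of \<open>R l h\<close>. Absorbing it gives the bound \<open>2 * M * norm h\<close> for
    \<open>R l h\<close>, and a second use of the identity leaves the small factor
    \<open>cmod (m - l)\<close>.\<close>
  have bd: "norm (R l h - R m h) \<le> cmod (m - l) * (M * (2 * M * norm h))"
    if l: "l \<in> \<rho>" "cmod (m - l) < 1 / (2 * M)" for l
  proof -
    have "norm (R l h - R m h) \<le> cmod (m - l) * (M * norm (R l h))"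
      unfolding resolvent_identity[OF l(1) m] norm_scaleC by (intro mult_left_mono M) auto
    also have "\<dots> \<le> (1 / (2 * M)) * (M * norm (R l h))"
      using l M by (intro mult_right_mono) auto
    also have "\<dots> = norm (R l h) / 2" using M by simp
    finally have "norm (R l h - R m h) \<le> norm (R l h) / 2" .
    then have "norm (R l h) \<le> 2 * norm (R m h)"
      using norm_triangle_sub[of "R l h" "R m h"] by simp
    then have *: "norm (R l h) \<le> 2 * M * norm h" using M(2)[of h] by simp
    show ?thesis
      by (rule order_trans[OF \<open>norm (R l h - R m h) \<le> cmod (m - l) * (M * norm (R l h))\<close>])
         (use * M in \<open>intro mult_left_mono, auto\<close>)
  qed
  have "((\<lambda>l. R l h - R m h) \<longlongrightarrow> 0) (at m within \<rho>)"
  proof (rule Lim_null_comparison)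
    show "\<forall>\<^sub>F l in at m within \<rho>. norm (R l h - R m h) \<le> cmod (m - l) * (M * (2 * M * norm h))"
      unfolding eventually_at using bd M
      by (intro exI[of _ "1 / (2 * M)"]) (auto simp: dist_norm norm_minus_commute)
    show "((\<lambda>l. cmod (m - l) * (M * (2 * M * norm h))) \<longlongrightarrow> 0) (at m within \<rho>)"
      by (auto intro!: tendsto_eq_intros)
  qed
  then show "((\<lambda>l. R l h) \<longlongrightarrow> R m h) (at m within \<rho>)"
    using LIM_zero_iff by blast
qed

text \<open>On \<open>D\<close> the semigroup commutes with \<open>A\<close>, so applying
  \<open>S t\<close> to \<open>(l - A) R l h = h\<close> exhibits \<open>S t (R l h)\<close> as the
  preimage of \<open>S t h\<close>.\<close>

lemma S_R: "l \<in> \<rho> \<Longrightarrow> t \<ge> 0 \<Longrightarrow> S t (R l h) = R l (S t h)"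
proof -
  assume l: "l \<in> \<rho>" and t: "t \<ge> 0"
  interpret bounded_linear "S t" by (rule S_linear[OF t])
  have "S t h = l *\<^sub>C S t (R l h) - A (S t (R l h))"
    using S_invariant[OF t R_in_D[OF l], of h] A_R[OF l, of h]
    by (simp add: diff bounded_clinear_scaleC[OF S_bounded[OF t]])
  then show ?thesis
    using R_left[OF l, of "S t (R l h)"] S_invariant[OF t R_in_D[OF l], of h] by simp
qed

text \<open>Since \<open>D\<close> is invariant under \<open>S\<close>, it contains the difference quotients converging to
  \<open>A x\<close>, so the closure of \<open>D\<close> contains \<open>h = l R h - A R h\<close>.\<close>

lemma domain_dense:
  assumes l: "l \<in> \<rho>" and orth: "\<And>x. x \<in> D \<Longrightarrow> cinner x \<psi> = 0"
  shows "\<psi> = 0"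
proof -
  have A_orth: "inner (A x) \<psi> = 0" if x: "x \<in> D" for x
  proof -
    have "((\<lambda>t. inner ((S t x - x) /\<^sub>R t) \<psi>) \<longlongrightarrow> inner (A x) \<psi>) (at_right 0)"
      by (intro tendsto_intros generator_tendsto x)
    moreover have "((\<lambda>t. inner ((S t x - x) /\<^sub>R t) \<psi>) \<longlongrightarrow> 0) (at_right 0)"
    proof (rule tendsto_eventually)
      show "\<forall>\<^sub>F t in at_right 0. inner ((S t x - x) /\<^sub>R t) \<psi> = 0"
        using eventually_at_right_0
      proof eventually_elim
        case (elim t)
        then have "S t x - x \<in> D" using S_invariant[of t x] D_diff x by simp
        then have "inner (S t x - x) \<psi> = 0" using orth Re_cinner[of _ \<psi>] by (metis zero_complex.sel(1))
        then show ?case by simp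
      qed
    qed
    ultimately show ?thesis
      using tendsto_unique trivial_limit_at_right_real by blast
  qed
  have "inner \<psi> \<psi> = Re (cinner (l *\<^sub>C R l \<psi>) \<psi>) - inner (A (R l \<psi>)) \<psi>"
    unfolding Re_cinner using R_right[OF l, of \<psi>] by (metis inner_diff_left)
  also have "\<dots> = 0"
    using orth[OF R_in_D[OF l]] A_orth[OF R_in_D[OF l]] by (simp add: cinner_scaleC_left)
  finally show ?thesis by simp
qed

end

section \<open>Contour integrals of the resolvent\<close>

locale resolvent_contour = semigroup_generator D A S
  for D :: "'h::complex_hilbert set" and A S +
  fixes z :: complex and r :: real
  assumes r_pos: "r > 0" and sphere_resolvent: "sphere z r \<subseteq> resolvent_set D A"
begin

definition \<gamma> :: "real \<Rightarrow> complex"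
  where "\<gamma> \<theta> = z + of_real r * cis \<theta>"

text \<open>The factor \<open>d\<lambda>\<close> of a contour integral is to be absorbed in the weight \<open>f\<close>.\<close>

definition Q :: "(real \<Rightarrow> complex) \<Rightarrow> 'h \<Rightarrow> 'h"
  where "Q f h = integral {0..2 * pi} (\<lambda>\<theta>. f \<theta> *\<^sub>C R (\<gamma> \<theta>) h)"

lemma \<gamma>_resolvent: "\<gamma> \<theta> \<in> \<rho>"
  using sphere_resolvent r_pos by (auto simp: \<gamma>_def dist_norm norm_mult)

lemma continuous_on_\<gamma> [continuous_intros]: "continuous_on X \<gamma>"
  unfolding \<gamma>_def by (intro continuous_intros)

lemma continuous_on_R_\<gamma> [continuous_intros]: "continuous_on X (\<lambda>\<theta>. R (\<gamma> \<theta>) h)"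
  by (rule continuous_on_compose2[OF continuous_on_R continuous_on_\<gamma>]) (use \<gamma>_resolvent in auto)

lemma Q_has_integral:
  assumes "continuous_on {0..2 * pi} f"
  shows "((\<lambda>\<theta>. f \<theta> *\<^sub>C R (\<gamma> \<theta>) h) has_integral Q f h) {0..2 * pi}"
  unfolding Q_def using assms
  by (intro integrable_integral integrable_continuous_real continuous_intros)

text \<open>Continuity is available only vector by vector. Compactness of the parameter interval
  gives pointwise bounds, and uniform boundedness turns them into an operator bound.\<close>

lemma R_uniformly_bounded:
  obtains M where "M > 0" "\<And>\<theta> h. \<theta> \<in> {0..2 * pi} \<Longrightarrow> norm (R (\<gamma> \<theta>) h) \<le> M * norm h"
proof (rule uniform_boundedness[of "{0..2 * pi}" "\<lambda>\<theta>. R (\<gamma> \<theta>)"])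
  fix h
  have "compact ((\<lambda>\<theta>. R (\<gamma> \<theta>) h) ` {0..2 * pi})"
    by (intro compact_continuous_image continuous_intros) simp
  then show "\<exists>C. \<forall>\<theta>\<in>{0..2 * pi}. norm (R (\<gamma> \<theta>) h) \<le> C"
    using compact_imp_bounded bounded_iff by (metis imageI)
qed (use R_linear[OF \<gamma>_resolvent] that in auto)

text \<open>The constant depends on the circle alone, so decay of the weights passes directly to the
  operators.\<close>

lemma Q_norm_bound:
  obtains M where "M > 0"
    "\<And>f C h. continuous_on {0..2 * pi} f \<Longrightarrow> (\<And>\<theta>. \<theta> \<in> {0..2 * pi} \<Longrightarrow> cmod (f \<theta>) \<le> C) \<Longrightarrow>
      norm (Q f h) \<le> M * C * norm h"
proof -
  obtain M where M: "M > 0" "\<And>\<theta> h. \<theta> \<in> {0..2 * pi} \<Longrightarrow> norm (R (\<gamma> \<theta>) h) \<le> M * norm h"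
    using R_uniformly_bounded by metis
  have "norm (Q f h) \<le> (2 * pi * M) * C * norm h"
    if f: "continuous_on {0..2 * pi} f" and C: "\<And>\<theta>. \<theta> \<in> {0..2 * pi} \<Longrightarrow> cmod (f \<theta>) \<le> C" for f C h
  proof -
    have C0: "0 \<le> C" by (rule order_trans[OF norm_ge_zero C[of 0]]) simp
    have "norm (Q f h) \<le> (C * (M * norm h)) * measure lborel (cbox 0 (2 * pi))"
    proof (rule has_integral_bound)
      show "((\<lambda>\<theta>. f \<theta> *\<^sub>C R (\<gamma> \<theta>) h) has_integral Q f h) (cbox 0 (2 * pi))"
        using Q_has_integral[OF f] by (simp add: cbox_interval)
      show "norm (f \<theta> *\<^sub>C R (\<gamma> \<theta>) h) \<le> C * (M * norm h)" if "\<theta> \<in> cbox 0 (2 * pi)" for \<theta>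
        using that C0 unfolding norm_scaleC by (intro mult_mono C M) (auto simp: cbox_interval)
    qed (use C0 M in auto)
    then show ?thesis by (simp add: mult_ac)
  qed
  moreover have "2 * pi * M > 0" using M by simp
  ultimately show ?thesis using that by blast
qed

text \<open>A bounded operator passes under the integral. The second vector \<open>k\<close>
  accommodates operators such as \<open>S t\<close>, which reappear inside the resolvent as
  \<open>S t h\<close>.\<close>

lemma Q_commute:
  assumes f: "continuous_on {0..2 * pi} f" and T: "bounded_clinear T"
    and comm: "\<And>\<theta>. T (R (\<gamma> \<theta>) h) = R (\<gamma> \<theta>) k"
  shows "T (Q f h) = Q f k"
proof -
  from has_integral_linear[OF Q_has_integral[OF f, of h] bounded_clinear_bounded_linear[OF T]]
  have "((\<lambda>\<theta>. f \<theta> *\<^sub>C R (\<gamma> \<theta>) k) has_integral T (Q f h)) {0..2 * pi}"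
    by (simp add: o_def bounded_clinear_scaleC[OF T] comm)
  then show ?thesis using Q_has_integral[OF f, of k] has_integral_unique by blast
qed

lemma Q_add_weight:
  assumes "continuous_on {0..2 * pi} f" "continuous_on {0..2 * pi} g"
  shows "Q (\<lambda>\<theta>. f \<theta> + g \<theta>) h = Q f h + Q g h"
proof -
  have "((\<lambda>\<theta>. (f \<theta> + g \<theta>) *\<^sub>C R (\<gamma> \<theta>) h) has_integral Q f h + Q g h) {0..2 * pi}"
    using has_integral_add[OF Q_has_integral[OF assms(1), of h] Q_has_integral[OF assms(2), of h]]
    by (simp add: scaleC_add_left)
  then show ?thesis unfolding Q_def by (rule integral_unique)
qed

lemma bounded_clinear_scaleC_self: "bounded_clinear ((*\<^sub>C) c :: 'h \<Rightarrow> 'h)"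
  unfolding bounded_clinear_on_def
  by (auto simp: scaleC_add_right scaleC_scaleC mult.commute intro!: exI[of _ "cmod c"])

lemma Q_scale_weight:
  assumes "continuous_on {0..2 * pi} f"
  shows "Q (\<lambda>\<theta>. c * f \<theta>) h = c *\<^sub>C Q f h"
proof -
  have "((\<lambda>\<theta>. (c * f \<theta>) *\<^sub>C R (\<gamma> \<theta>) h) has_integral c *\<^sub>C Q f h) {0..2 * pi}"
    using has_integral_linear[OF Q_has_integral[OF assms, of h]
        bounded_clinear_bounded_linear[OF bounded_clinear_scaleC_self, of c]]
    by (simp add: o_def scaleC_scaleC)
  then show ?thesis unfolding Q_def by (rule integral_unique)
qed

lemma Q_bounded:
  assumes f: "continuous_on {0..2 * pi} f"
  shows "bounded_clinear (Q f)"
  unfolding bounded_clinear_on_def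
proof (intro conjI ballI allI)
  fix x y c
  have "((\<lambda>\<theta>. f \<theta> *\<^sub>C R (\<gamma> \<theta>) (x + y)) has_integral Q f x + Q f y) {0..2 * pi}"
    using has_integral_add[OF Q_has_integral[OF f, of x] Q_has_integral[OF f, of y]]
    by (simp add: scaleC_add_right bounded_clinear_add[OF R_bounded[OF \<gamma>_resolvent]])
  then show "Q f (x + y) = Q f x + Q f y" unfolding Q_def by (rule integral_unique)
  show "Q f (c *\<^sub>C x) = c *\<^sub>C Q f x"
    by (rule Q_commute[OF f bounded_clinear_scaleC_self, symmetric])
       (simp add: bounded_clinear_scaleC[OF R_bounded[OF \<gamma>_resolvent]])
next
  obtain M where M: "\<And>f C h. continuous_on {0..2 * pi} f \<Longrightarrow>
      (\<And>\<theta>. \<theta> \<in> {0..2 * pi} \<Longrightarrow> cmod (f \<theta>) \<le> C) \<Longrightarrow> norm (Q f h) \<le> M * C * norm h"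
    using Q_norm_bound by metis
  have "compact (f ` {0..2 * pi})" by (intro compact_continuous_image f) simp
  then obtain C where "\<And>\<theta>. \<theta> \<in> {0..2 * pi} \<Longrightarrow> cmod (f \<theta>) \<le> C"
    using compact_imp_bounded bounded_iff by (metis imageI)
  then show "\<exists>K. \<forall>x\<in>UNIV. norm (Q f x) \<le> K * norm x" using M[OF f] by blast
qed auto

text \<open>The unbounded \<open>A\<close> cannot be pulled out of an integral by linearity. Writing
  the integrand as the bounded \<open>R (\<gamma> 0)\<close> applied to a continuous function does
  this job, in place of an argument with closedness of \<open>A\<close>.\<close>

lemma Q_eq_R:
  assumes f: "continuous_on {0..2 * pi} f"
  shows "Q f h = R (\<gamma> 0) (\<gamma> 0 *\<^sub>C Q f h - Q (\<lambda>\<theta>. \<gamma> \<theta> * f \<theta>) h + integral {0..2 * pi} f *\<^sub>C h)"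
proof -
  let ?m = "\<gamma> 0"
  have cf: "continuous_on {0..2 * pi} (\<lambda>\<theta>. \<gamma> \<theta> * f \<theta>)" by (intro continuous_intros f)
  note m = \<gamma>_resolvent[of 0]
  \<comment> \<open>The new integrand is \<open>?m - A\<close> applied to
    \<open>f \<theta> *\<^sub>C R (\<gamma> \<theta>) h\<close>, with \<open>A\<close> eliminated
    through \<open>A_R\<close>.\<close>
  have "((\<lambda>\<theta>. ?m *\<^sub>C (f \<theta> *\<^sub>C R (\<gamma> \<theta>) h) - (\<gamma> \<theta> * f \<theta>) *\<^sub>C R (\<gamma> \<theta>) h + f \<theta> *\<^sub>C h) has_integral
      ?m *\<^sub>C Q f h - Q (\<lambda>\<theta>. \<gamma> \<theta> * f \<theta>) h + integral {0..2 * pi} f *\<^sub>C h) {0..2 * pi}"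
    by (intro has_integral_add has_integral_diff Q_has_integral f cf
        has_integral_linear[OF _ bounded_clinear_bounded_linear[OF bounded_clinear_scaleC_self], unfolded o_def]
        has_integral_linear[OF _ bounded_bilinear.bounded_linear_left[OF bounded_bilinear_scaleC], unfolded o_def]
        integrable_integral integrable_continuous_real)
  from has_integral_linear[OF this R_linear[OF m]]
  have "((\<lambda>\<theta>. R ?m (?m *\<^sub>C (f \<theta> *\<^sub>C R (\<gamma> \<theta>) h) - (\<gamma> \<theta> * f \<theta>) *\<^sub>C R (\<gamma> \<theta>) h + f \<theta> *\<^sub>C h)) has_integral
      R ?m (?m *\<^sub>C Q f h - Q (\<lambda>\<theta>. \<gamma> \<theta> * f \<theta>) h + integral {0..2 * pi} f *\<^sub>C h)) {0..2 * pi}"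
    by (simp add: o_def)
  moreover have "R ?m (?m *\<^sub>C (f \<theta> *\<^sub>C R (\<gamma> \<theta>) h) - (\<gamma> \<theta> * f \<theta>) *\<^sub>C R (\<gamma> \<theta>) h + f \<theta> *\<^sub>C h)
      = f \<theta> *\<^sub>C R (\<gamma> \<theta>) h" for \<theta>
  proof -
    have "?m *\<^sub>C (f \<theta> *\<^sub>C R (\<gamma> \<theta>) h) - (\<gamma> \<theta> * f \<theta>) *\<^sub>C R (\<gamma> \<theta>) h + f \<theta> *\<^sub>C h
      = f \<theta> *\<^sub>C (?m *\<^sub>C R (\<gamma> \<theta>) h - A (R (\<gamma> \<theta>) h))"
      by (simp add: A_R[OF \<gamma>_resolvent] scaleC_diff_right scaleC_scaleC mult.commute)
    then show ?thesis
      by (simp add: bounded_clinear_scaleC[OF R_bounded[OF m]] R_left[OF m R_in_D[OF \<gamma>_resolvent]])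
  qed
  ultimately have "((\<lambda>\<theta>. f \<theta> *\<^sub>C R (\<gamma> \<theta>) h) has_integral
      R ?m (?m *\<^sub>C Q f h - Q (\<lambda>\<theta>. \<gamma> \<theta> * f \<theta>) h + integral {0..2 * pi} f *\<^sub>C h)) {0..2 * pi}"
    by simp
  then show ?thesis by (rule has_integral_unique[OF Q_has_integral[OF f]])
qed

lemma Q_in_D: "continuous_on {0..2 * pi} f \<Longrightarrow> Q f h \<in> D"
  by (subst Q_eq_R, assumption) (rule R_in_D[OF \<gamma>_resolvent])

lemma A_Q:
  assumes f: "continuous_on {0..2 * pi} f"
  shows "A (Q f h) = Q (\<lambda>\<theta>. \<gamma> \<theta> * f \<theta>) h - integral {0..2 * pi} f *\<^sub>C h"
proof -
  let ?g = "\<gamma> 0 *\<^sub>C Q f h - Q (\<lambda>\<theta>. \<gamma> \<theta> * f \<theta>) h + integral {0..2 * pi} f *\<^sub>C h"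
  have "A (Q f h) = A (R (\<gamma> 0) ?g)" by (rule arg_cong[OF Q_eq_R[OF f]])
  also have "\<dots> = \<gamma> 0 *\<^sub>C Q f h - ?g"
    by (subst A_R[OF \<gamma>_resolvent]) (simp only: Q_eq_R[OF f, symmetric])
  finally show ?thesis by simp
qed

text \<open>Under the integral this is \<open>R_A\<close>. Taking adjoints in this commutation is
  what later places vectors in \<open>Dstar\<close>.\<close>

lemma Q_A:
  assumes f: "continuous_on {0..2 * pi} f" and x: "x \<in> D"
  shows "Q f (A x) = A (Q f x)"
proof -
  have cf: "continuous_on {0..2 * pi} (\<lambda>\<theta>. \<gamma> \<theta> * f \<theta>)" by (intro continuous_intros f)
  have "((\<lambda>\<theta>. (\<gamma> \<theta> * f \<theta>) *\<^sub>C R (\<gamma> \<theta>) x - f \<theta> *\<^sub>C x) has_integral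
      Q (\<lambda>\<theta>. \<gamma> \<theta> * f \<theta>) x - integral {0..2 * pi} f *\<^sub>C x) {0..2 * pi}"
    by (intro has_integral_diff Q_has_integral cf
        has_integral_linear[OF _ bounded_bilinear.bounded_linear_left[OF bounded_bilinear_scaleC], unfolded o_def]
        integrable_integral integrable_continuous_real f)
  moreover have "(\<gamma> \<theta> * f \<theta>) *\<^sub>C R (\<gamma> \<theta>) x - f \<theta> *\<^sub>C x = f \<theta> *\<^sub>C R (\<gamma> \<theta>) (A x)" for \<theta>
    by (simp add: R_A[OF \<gamma>_resolvent x] A_R[OF \<gamma>_resolvent] scaleC_diff_right scaleC_scaleC mult.commute)
  ultimately have "((\<lambda>\<theta>. f \<theta> *\<^sub>C R (\<gamma> \<theta>) (A x)) has_integral A (Q f x)) {0..2 * pi}"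
    by (simp add: A_Q[OF f])
  then show ?thesis unfolding Q_def[of f "A x"] by (rule integral_unique)
qed

lemma S_Q:
  assumes "continuous_on {0..2 * pi} f" and "t \<ge> 0"
  shows "S t (Q f h) = Q f (S t h)"
  by (rule Q_commute[OF assms(1) S_bounded[OF assms(2)] S_R[OF \<gamma>_resolvent assms(2)]])

text \<open>Up to the factor \<open>2 \<pi>\<close> the following weight yields the Riesz projection at \<open>s = 0\<close>, and
  for general \<open>s\<close> the propagator \<open>e\<^sup>-\<^sup>A\<^sup>s\<close> on its range.\<close>

definition w :: "real \<Rightarrow> real \<Rightarrow> complex"
  where "w s \<theta> = exp (- of_real s * \<gamma> \<theta>) * (of_real r * cis \<theta>)"

lemma continuous_on_w [continuous_intros]: "continuous_on X (w s)"
  unfolding w_def by (intro continuous_intros)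

text \<open>Up to the factor \<i> this is the integral of the entire function exp (- s l) along a
  closed circle, so a primitive suffices. The vanishing removes the multiple of \<open>h\<close>
  from \<open>A_Q\<close>.\<close>

lemma integral_w: "integral {0..2 * pi} (w s) = 0"
proof -
  define F where "F x = (if s = 0 then x else exp (- of_real s * x) / (- of_real s))" for x :: complex
  have F: "(F has_field_derivative exp (- of_real s * x)) (at x)" for x
  proof (cases "s = 0")
    case True
    then show ?thesis unfolding F_def by (auto intro!: derivative_eq_intros)
  next
    case False
    then show ?thesis unfolding F_def
      by (auto intro!: derivative_eq_intros simp: field_simps)
  qed
  have "((\<lambda>\<theta>. F (\<gamma> \<theta>)) has_vector_derivative \<i> * w s \<theta>) (at \<theta> within {0..2 * pi})" for \<theta>
  proof -
    have "(\<gamma> has_vector_derivative \<i> * (of_real r * cis \<theta>)) (at \<theta> within {0..2 * pi})"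
      unfolding \<gamma>_def cis_conv_exp
      using exp_scaleR_has_vector_derivative_right[of \<i> \<theta> "{0..2 * pi}"]
      by (auto intro!: derivative_eq_intros simp: scaleR_conv_of_real mult_ac)
    from field_vector_diff_chain_within[OF this has_field_derivative_at_within[OF F]]
    show ?thesis by (simp add: o_def w_def mult_ac)
  qed
  then have "((\<lambda>\<theta>. \<i> * w s \<theta>) has_integral F (\<gamma> (2 * pi)) - F (\<gamma> 0)) {0..2 * pi}"
    by (intro fundamental_theorem_of_calculus) auto
  then have "((\<lambda>\<theta>. \<i> * w s \<theta>) has_integral 0) {0..2 * pi}" by (simp add: \<gamma>_def)
  from has_integral_mult_right[OF this, of "-\<i>"] show ?thesis
    by (simp add: integral_unique flip: mult.assoc)
qed

lemma A_Q_w: "A (Q (w s) h) = Q (\<lambda>\<theta>. \<gamma> \<theta> * w s \<theta>) h"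
  by (simp add: A_Q[OF continuous_on_w] integral_w)

text \<open>Differentiation under the integral produces the factor
  \<open>- \<gamma> \<theta>\<close>, which \<open>A_Q_w\<close> identifies with \<open>- A\<close>.
  The orbit is thus of the kind treated in \<open>S_backward_orbit\<close>.\<close>

lemma Q_w_deriv: "((\<lambda>s. Q (w s) h) has_vector_derivative - A (Q (w s) h)) (at s)"
proof -
  let ?f = "\<lambda>s \<theta>. w s \<theta> *\<^sub>C R (\<gamma> \<theta>) h"
  let ?f' = "\<lambda>s \<theta>. - ((\<gamma> \<theta> * w s \<theta>) *\<^sub>C R (\<gamma> \<theta>) h)"
  have "((\<lambda>s. integral (cbox 0 (2 * pi)) (?f s)) has_vector_derivative
      integral (cbox 0 (2 * pi)) (?f' s)) (at s within UNIV)"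
  proof (rule leibniz_rule_vector_derivative)
    fix s \<theta> :: real
    have "((\<lambda>s. w s \<theta>) has_vector_derivative - (\<gamma> \<theta> * w s \<theta>)) (at s)"
      unfolding w_def using exp_scaleR_has_vector_derivative_right[of "- \<gamma> \<theta>" s UNIV]
      by (auto intro!: derivative_eq_intros simp: scaleR_conv_of_real mult_ac)
    from bounded_linear.has_vector_derivative[OF
        bounded_bilinear.bounded_linear_left[OF bounded_bilinear_scaleC] this, of "R (\<gamma> \<theta>) h"]
    show "((\<lambda>s. ?f s \<theta>) has_vector_derivative ?f' s \<theta>) (at s within UNIV)"
      by (simp add: scaleC_minus_left)
  next
    fix s
    show "?f s integrable_on cbox 0 (2 * pi)"
      using Q_has_integral[OF continuous_on_w] by (auto simp: cbox_interval)
  next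
    show "continuous_on (UNIV \<times> cbox 0 (2 * pi)) (\<lambda>(s, \<theta>). ?f' s \<theta>)"
      unfolding w_def split_beta
      by (intro continuous_intros continuous_on_compose2[OF continuous_on_\<gamma>[of UNIV]]
          continuous_on_compose2[OF continuous_on_R_\<gamma>[of UNIV]]) auto
  qed auto
  then show ?thesis
    unfolding A_Q_w by (simp add: cbox_interval Q_def)
qed

lemma S_Q_w_add:
  assumes "t \<ge> 0"
  shows "S t (Q (w (s + t)) h) = Q (w s) h"
proof -
  have "((\<lambda>t. Q (w (s + t)) h) has_vector_derivative - A (Q (w (s + t)) h)) (at t)" for t
  proof -
    have "((\<lambda>t. s + t) has_vector_derivative 1) (at t)"
      by (auto intro!: derivative_eq_intros)
    from vector_diff_chain_at[OF this Q_w_deriv] show ?thesis by (simp add: o_def)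
  qed
  then show ?thesis
    using S_backward_orbit[where v = "\<lambda>t. Q (w (s + t)) h", OF Q_in_D[OF continuous_on_w] _ assms]
    by simp
qed

lemma S_Q_w: "t \<ge> 0 \<Longrightarrow> S t (Q (w t) h) = Q (w 0) h"
  using S_Q_w_add[of t 0] by simp

text \<open>If the contour integral of the resolvent \<open>R l\<close> vanishes, then that of \<open>(l - z)\<^sup>-\<^sup>1 R l\<close> inverts
  \<open>z - A\<close> up to the factor \<open>2 \<pi>\<close>.\<close>

lemma Q_w_0_nonzero:
  assumes "z \<in> spectrum D A"
  shows "\<exists>h. Q (w 0) h \<noteq> 0"
proof (rule ccontr)
  assume "\<not> ?thesis"
  then have 0: "Q (w 0) h = 0" for h by blast
  \<comment> \<open>In terms of the angle, the contour form dl / (2 pi i (l - z)) is the constant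
    weight 1/(2 pi).\<close>
  define c :: complex where "c = of_real (1 / (2 * pi))"
  let ?J = "Q (\<lambda>_. c)"
  have cc: "continuous_on {0..2 * pi} (\<lambda>_. c)" by (intro continuous_intros)
  have J: "bounded_clinear ?J" by (rule Q_bounded[OF cc])
  have JD: "?J h \<in> D" for h by (rule Q_in_D[OF cc])
  \<comment> \<open>Because \<open>\<gamma> \<theta> - z = w 0 \<theta>\<close>, replacing
    \<open>\<gamma> \<theta>\<close> by \<open>z\<close> costs a multiple of \<open>Q (w 0)\<close>,
    which vanishes by assumption.\<close>
  have "(\<lambda>\<theta>. \<gamma> \<theta> * c) = (\<lambda>\<theta>. z * c + c * w 0 \<theta>)"
    by (simp add: \<gamma>_def w_def algebra_simps)
  then have "Q (\<lambda>\<theta>. \<gamma> \<theta> * c) h = z *\<^sub>C ?J h" for h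
    using Q_add_weight[of "\<lambda>_. z * c" "\<lambda>\<theta>. c * w 0 \<theta>" h]
      Q_scale_weight[OF cc, of z h] Q_scale_weight[OF continuous_on_w, of c 0 h] 0
    by (simp add: continuous_intros)
  moreover have "integral {0..2 * pi} (\<lambda>_. c) = 1"
    by (simp add: c_def scaleR_conv_of_real)
  ultimately have AJ: "A (?J h) = z *\<^sub>C ?J h - h" for h
    by (simp add: A_Q[OF cc])
  let ?f = "\<lambda>x. z *\<^sub>C x - A x"
  have fJ: "?f (?J h) = h" for h using AJ by simp
  have Jf: "?J (?f x) = x" if x: "x \<in> D" for x
  proof -
    interpret J: bounded_linear ?J by (rule bounded_clinear_bounded_linear[OF J])
    have "?J (?f x) = z *\<^sub>C ?J x - ?J (A x)"
      by (simp only: J.diff bounded_clinear_scaleC[OF J])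
    then show ?thesis using Q_A[OF cc x] fJ[of x] by simp
  qed
  have inj: "inj_on ?f D" by (rule inj_on_inverseI[of _ ?J]) (rule Jf)
  have bij: "bij_betw ?f D UNIV"
    unfolding bij_betw_def using inj fJ JD by (auto intro!: image_eqI[of _ ?f "?J _"])
  have "inv_into D ?f = ?J"
    by (rule ext) (rule inv_into_f_eq[OF inj JD fJ])
  then have "z \<in> resolvent_set D A"
    using bij J by (simp add: resolvent_set_def)
  then show False using assms by (simp add: spectrum_def)
qed

end

section \<open>The dual of the domain of the adjoint\<close>

lemma cinner_eqI: "(\<And>x. cinner x a = cinner x b) \<Longrightarrow> a = b"
proof -
  assume "\<And>x. cinner x a = cinner x b"
  then have "cinner (a - b) (a - b) = 0" by (simp add: cinner_diff_right)
  then show "a = b" by (simp add: cinner_self)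
qed

lemma cinner_eqI_left: "(\<And>x. cinner a x = cinner b x) \<Longrightarrow> a = b"
  by (rule cinner_eqI) (metis cinner_commute)

locale resolvent_point = semigroup_generator D A S
  for D :: "'h::complex_hilbert set" and A S +
  fixes m :: complex
  assumes m: "m \<in> resolvent_set D A"
begin

abbreviation "Dstar \<equiv> adj_dom D A"
abbreviation "Astar \<equiv> adj D A"
abbreviation "gnorm \<equiv> adj_graph_norm D A"
abbreviation "X \<equiv> adj_dual D A"
abbreviation "N \<equiv> adj_dual_norm D A"

text \<open>Uniqueness of \<open>\<psi>\<close> is the density of \<open>D\<close>, obtained from
  \<open>domain_dense\<close>; it makes the description in \<open>adj\<close> well defined.\<close>

lemma adj_unique:
  assumes "\<And>x. x \<in> D \<Longrightarrow> cinner (A x) \<phi> = cinner x \<psi>"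
  shows "\<phi> \<in> Dstar" "Astar \<phi> = \<psi>"
proof -
  show "\<phi> \<in> Dstar" using assms by (auto simp: adj_dom_def)
  show "Astar \<phi> = \<psi>" unfolding adj_def
  proof (rule the_equality)
    fix \<psi>' assume "\<forall>x\<in>D. cinner (A x) \<phi> = cinner x \<psi>'"
    then have "\<psi>' - \<psi> = 0"
      by (intro domain_dense[OF m]) (simp add: cinner_diff_right assms[symmetric])
    then show "\<psi>' = \<psi>" by simp
  qed (use assms in auto)
qed

lemma cinner_adj: "\<phi> \<in> Dstar \<Longrightarrow> x \<in> D \<Longrightarrow> cinner (A x) \<phi> = cinner x (Astar \<phi>)"
proof -
  assume \<phi>: "\<phi> \<in> Dstar" and x: "x \<in> D"
  obtain \<psi> where \<psi>: "\<And>x. x \<in> D \<Longrightarrow> cinner (A x) \<phi> = cinner x \<psi>"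
    using \<phi> by (auto simp: adj_dom_def)
  show ?thesis using adj_unique(2)[OF \<psi>] \<psi>[OF x] by simp
qed

lemma Dstar_add:
  assumes "\<phi> \<in> Dstar" "\<eta> \<in> Dstar"
  shows "\<phi> + \<eta> \<in> Dstar" "Astar (\<phi> + \<eta>) = Astar \<phi> + Astar \<eta>"
  using adj_unique[of "\<phi> + \<eta>" "Astar \<phi> + Astar \<eta>"] assms
  by (auto simp: cinner_add_right cinner_adj)

lemma Dstar_scaleC:
  assumes "\<phi> \<in> Dstar"
  shows "c *\<^sub>C \<phi> \<in> Dstar" "Astar (c *\<^sub>C \<phi>) = c *\<^sub>C Astar \<phi>"
  using adj_unique[of "c *\<^sub>C \<phi>" "c *\<^sub>C Astar \<phi>"] assms
  by (auto simp: cinner_scaleC_right cinner_adj)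

lemma Dstar_0: "0 \<in> Dstar" "Astar 0 = 0"
  using adj_unique[of 0 0] by auto

lemma gnorm_nonneg: "0 \<le> gnorm \<phi>"
  and norm_le_gnorm: "norm \<phi> \<le> gnorm \<phi>"
  and norm_adj_le_gnorm: "norm (Astar \<phi>) \<le> gnorm \<phi>"
  and gnorm_le: "gnorm \<phi> \<le> norm \<phi> + norm (Astar \<phi>)"
  unfolding adj_graph_norm_def
  by (auto intro: real_le_rsqrt sqrt_sum_squares_le_sum)

lemma gnorm_scaleC: "\<phi> \<in> Dstar \<Longrightarrow> gnorm (c *\<^sub>C \<phi>) = cmod c * gnorm \<phi>"
  unfolding adj_graph_norm_def
  by (simp add: Dstar_scaleC power_mult_distrib real_sqrt_mult flip: distrib_left)

lemma X_outside: "\<psi> \<in> X \<Longrightarrow> \<phi> \<notin> Dstar \<Longrightarrow> \<psi> \<phi> = 0"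
  and X_add: "\<psi> \<in> X \<Longrightarrow> \<phi> \<in> Dstar \<Longrightarrow> \<eta> \<in> Dstar \<Longrightarrow> \<psi> (\<phi> + \<eta>) = \<psi> \<phi> + \<psi> \<eta>"
  and X_scaleC: "\<psi> \<in> X \<Longrightarrow> \<phi> \<in> Dstar \<Longrightarrow> \<psi> (c *\<^sub>C \<phi>) = cnj c * \<psi> \<phi>"
  by (auto simp: adj_dual_def)

text \<open>\<open>adj_dual_norm\<close> is a supremum of reals, so estimating a value by it
  requires boundedness first.\<close>

lemma X_bdd: "\<psi> \<in> X \<Longrightarrow> bdd_above ((\<lambda>\<phi>. cmod (\<psi> \<phi>)) ` {\<phi> \<in> Dstar. gnorm \<phi> \<le> 1})"
proof -
  assume "\<psi> \<in> X"
  then obtain K where K: "\<And>\<phi>. \<phi> \<in> Dstar \<Longrightarrow> cmod (\<psi> \<phi>) \<le> K * gnorm \<phi>"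
    unfolding adj_dual_def by blast
  show ?thesis
  proof (rule bdd_aboveI2)
    fix \<phi> assume *: "\<phi> \<in> {\<phi> \<in> Dstar. gnorm \<phi> \<le> 1}"
    then have "cmod (\<psi> \<phi>) \<le> \<bar>K\<bar> * gnorm \<phi>"
      by (intro order_trans[OF K] mult_right_mono gnorm_nonneg) auto
    also have "\<dots> \<le> \<bar>K\<bar>" using * by (simp add: mult_left_le)
    finally show "cmod (\<psi> \<phi>) \<le> \<bar>K\<bar>" .
  qed
qed

lemma N_nonneg: "\<psi> \<in> X \<Longrightarrow> 0 \<le> N \<psi>"
proof -
  assume \<psi>: "\<psi> \<in> X"
  have "0 \<le> cmod (\<psi> 0)" by simp
  also have "\<dots> \<le> N \<psi>" unfolding adj_dual_norm_def
    by (rule cSUP_upper[OF _ X_bdd[OF \<psi>]]) (simp add: Dstar_0 adj_graph_norm_def)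
  finally show ?thesis .
qed

lemma N_bound:
  assumes \<psi>: "\<psi> \<in> X" and \<phi>: "\<phi> \<in> Dstar"
  shows "cmod (\<psi> \<phi>) \<le> N \<psi> * gnorm \<phi>"
proof (cases "gnorm \<phi> = 0")
  case True
  obtain K where "cmod (\<psi> \<phi>) \<le> K * gnorm \<phi>"
    using \<psi> \<phi> by (auto simp: adj_dual_def)
  then show ?thesis using True by simp
next
  case False
  then have pos: "gnorm \<phi> > 0" using gnorm_nonneg[of \<phi>] by simp
  let ?c = "complex_of_real (1 / gnorm \<phi>)"
  have "cmod (\<psi> (?c *\<^sub>C \<phi>)) \<le> N \<psi>" unfolding adj_dual_norm_def
    by (rule cSUP_upper[OF _ X_bdd[OF \<psi>]])
       (use pos \<phi> in \<open>simp add: Dstar_scaleC gnorm_scaleC norm_divide\<close>)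
  then show ?thesis
    using pos by (simp add: X_scaleC[OF \<psi> \<phi>] norm_mult norm_divide field_simps)
qed

lemma N_le:
  assumes "\<And>\<phi>. \<phi> \<in> Dstar \<Longrightarrow> cmod (\<psi> \<phi>) \<le> C * gnorm \<phi>" and "C \<ge> 0"
  shows "N \<psi> \<le> C"
  unfolding adj_dual_norm_def
proof (rule cSUP_least)
  show "{\<phi> \<in> Dstar. gnorm \<phi> \<le> 1} \<noteq> {}"
    using Dstar_0 by (auto simp: adj_graph_norm_def intro!: exI[of _ 0])
  fix \<phi> assume *: "\<phi> \<in> {\<phi> \<in> Dstar. gnorm \<phi> \<le> 1}"
  then have "cmod (\<psi> \<phi>) \<le> C * gnorm \<phi>" using assms by simp
  also have "\<dots> \<le> C" using * assms(2) by (simp add: mult_left_le)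
  finally show "cmod (\<psi> \<phi>) \<le> C" .
qed

text \<open>\<open>Rs\<close> is the adjoint of \<open>R m\<close>, that is, the resolvent of
  \<open>Astar\<close> at \<open>cnj m\<close>. It identifies the Hilbert space with
  \<open>Dstar\<close> under the graph norm and yields the lower bound and bijectivity of
  \<open>J\<close>.\<close>

lemma adjoint_resolvent:
  obtains Rs K where "K > 0" "\<And>h. Rs h \<in> Dstar" "\<And>h. Astar (Rs h) = cnj m *\<^sub>C Rs h - h"
    "\<And>h. gnorm (Rs h) \<le> K * norm h"
    "\<And>x y. Rs (x + y) = Rs x + Rs y" "\<And>c x. Rs (c *\<^sub>C x) = c *\<^sub>C Rs x"
    "\<And>\<phi>. \<phi> \<in> Dstar \<Longrightarrow> Rs (cnj m *\<^sub>C \<phi> - Astar \<phi>) = \<phi>"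
proof -
  obtain K where K: "K > 0" "\<And>x. norm (R m x) \<le> K * norm x"
    using bounded_clinear_bound[OF R_bounded[OF m]] by metis
  have "\<exists>a. (\<forall>y. cinner (R m y) x = cinner y a) \<and> norm a \<le> K * norm x" for x
    using bounded_adjoint_exists[OF R_bounded[OF m] K(2), of x] K(1) by (metis less_imp_le)
  then obtain Rs where Rs: "\<And>x y. cinner (R m y) x = cinner y (Rs x)" "\<And>x. norm (Rs x) \<le> K * norm x"
    by metis
  \<comment> \<open>Moving \<open>Rs\<close> across turns it into \<open>R m\<close>, which commutes
    with \<open>A\<close>; then \<open>A_R\<close> leaves only bounded operators.\<close>
  have adj: "cinner (A x) (Rs h) = cinner x (cnj m *\<^sub>C Rs h - h)" if "x \<in> D" for x h
  proof -
    have "cinner (A x) (Rs h) = cinner (A (R m x)) h"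
      using Rs(1)[of "A x" h] R_A[OF m that] by simp
    then show ?thesis
      by (simp add: A_R[OF m] cinner_diff_left cinner_diff_right cinner_scaleC_left cinner_scaleC_right Rs)
  qed
  note Rs_D = adj_unique[OF adj]
  have gn: "gnorm (Rs h) \<le> (K + (cmod m * K + 1)) * norm h" for h
  proof -
    have "norm (Astar (Rs h)) \<le> cmod m * norm (Rs h) + norm h"
      using norm_triangle_ineq4[of "cnj m *\<^sub>C Rs h" h] by (simp add: Rs_D)
    also have "\<dots> \<le> cmod m * (K * norm h) + norm h"
      by (intro add_right_mono mult_left_mono Rs) simp
    finally show ?thesis
      using gnorm_le[of "Rs h"] Rs(2)[of h] by (simp add: algebra_simps)
  qed
  show ?thesis
  proof (rule that[of "K + (cmod m * K + 1)" Rs])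
    show "K + (cmod m * K + 1) > 0" using K(1) by (simp add: add_pos_nonneg)
    show "Rs (x + y) = Rs x + Rs y" for x y
      by (rule cinner_eqI) (simp add: cinner_add_right flip: Rs)
    show "Rs (c *\<^sub>C x) = c *\<^sub>C Rs x" for c x
      by (rule cinner_eqI) (simp add: cinner_scaleC_right flip: Rs)
    show "Rs (cnj m *\<^sub>C \<phi> - Astar \<phi>) = \<phi>" if \<phi>: "\<phi> \<in> Dstar" for \<phi>
    proof (rule cinner_eqI)
      fix x
      have "cinner x (Rs (cnj m *\<^sub>C \<phi> - Astar \<phi>)) = cinner (m *\<^sub>C R m x - A (R m x)) \<phi>"
        by (simp add: cinner_diff_left cinner_diff_right cinner_scaleC_left cinner_scaleC_right
            cinner_adj[OF \<phi> R_in_D[OF m]] flip: Rs)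
      then show "cinner x (Rs (cnj m *\<^sub>C \<phi> - Astar \<phi>)) = cinner x \<phi>"
        using R_right[OF m, of x] by simp
    qed
  qed (use Rs_D gn in auto)
qed

text \<open>\<open>J = m - \<A>\<close> is an isomorphism of \<open>H\<close> onto \<open>(dom A\<^sup>*)'\<close>.\<close>

definition J :: "'h \<Rightarrow> 'h \<Rightarrow> complex"
  where "J h = (\<lambda>\<phi>. if \<phi> \<in> Dstar then cinner h (cnj m *\<^sub>C \<phi> - Astar \<phi>) else 0)"

lemma J_add: "J (x + y) = J x + J y"
  by (auto simp: J_def fun_eq_iff cinner_add_left)

lemma J_scaleC: "J (c *\<^sub>C x) = c *\<^sub>C J x"
  by (auto simp: J_def fun_eq_iff cinner_scaleC_left scaleC_fun_def scaleC_complex_def)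

lemma J_diff: "J (x - y) = J x - J y"
  by (auto simp: J_def fun_eq_iff cinner_diff_left)

lemma J_bound: "\<phi> \<in> Dstar \<Longrightarrow> cmod (J h \<phi>) \<le> ((cmod m + 1) * norm h) * gnorm \<phi>"
proof -
  assume \<phi>: "\<phi> \<in> Dstar"
  have "cmod (J h \<phi>) \<le> norm h * norm (cnj m *\<^sub>C \<phi> - Astar \<phi>)"
    using \<phi> by (simp add: J_def cmod_cinner_le)
  also have "\<dots> \<le> norm h * (cmod m * norm \<phi> + norm (Astar \<phi>))"
    using norm_triangle_ineq4[of "cnj m *\<^sub>C \<phi>" "Astar \<phi>"] by (intro mult_left_mono) auto
  also have "\<dots> \<le> norm h * (cmod m * gnorm \<phi> + gnorm \<phi>)"
    by (intro mult_left_mono add_mono norm_le_gnorm norm_adj_le_gnorm) auto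
  finally show ?thesis by (simp add: algebra_simps)
qed

lemma J_in_X: "J h \<in> X"
  unfolding adj_dual_def
proof (intro CollectI conjI allI ballI impI)
  show "\<exists>K. \<forall>\<phi>\<in>Dstar. cmod (J h \<phi>) \<le> K * gnorm \<phi>" using J_bound by blast
qed (auto simp: J_def Dstar_add Dstar_scaleC cinner_add_right cinner_diff_right cinner_scaleC_right
    algebra_simps)

lemma N_J_le: "N (J h) \<le> (cmod m + 1) * norm h"
  by (rule N_le[OF J_bound]) auto

text \<open>The test vector \<open>Rs h\<close> satisfies \<open>(cnj m - Astar) (Rs h) = h\<close>,
  so \<open>J h\<close> takes the value of the squared norm of \<open>h\<close> there.\<close>

lemma J_lower:
  obtains C where "C > 0" "\<And>h. norm h \<le> C * N (J h)"
proof -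
  obtain Rs K where Rs: "K > 0" "\<And>h. Rs h \<in> Dstar" "\<And>h. Astar (Rs h) = cnj m *\<^sub>C Rs h - h"
    "\<And>h. gnorm (Rs h) \<le> K * norm h"
    by (rule adjoint_resolvent) blast
  have "norm h \<le> K * N (J h)" for h
  proof -
    have "norm h * norm h = cmod (J h (Rs h))"
      by (simp add: J_def Rs cinner_self power2_eq_square norm_mult)
    also have "\<dots> \<le> N (J h) * gnorm (Rs h)" by (rule N_bound[OF J_in_X Rs(2)])
    also have "\<dots> \<le> N (J h) * (K * norm h)" by (intro mult_left_mono Rs N_nonneg J_in_X)
    finally have "norm h * norm h \<le> (K * N (J h)) * norm h" by (simp add: mult_ac)
    then show ?thesis
      using Rs(1) N_nonneg[OF J_in_X] by (cases "h = 0") simp_all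
  qed
  then show ?thesis using that Rs(1) by blast
qed

lemma J_inject: "J x = J y \<longleftrightarrow> x = y"
proof
  assume eq: "J x = J y"
  obtain Rs K where Rs: "K > (0::real)" "\<And>h. Rs h \<in> Dstar" "\<And>h. Astar (Rs h) = cnj m *\<^sub>C Rs h - h"
    by (rule adjoint_resolvent) blast
  have J_Rs: "J v (Rs h) = cinner v h" for v h by (simp add: J_def Rs)
  show "x = y" by (rule cinner_eqI_left) (simp add: eq flip: J_Rs)
qed simp

text \<open>Composing \<open>\<psi>\<close> with \<open>Rs\<close> gives a bounded antilinear
  functional on the whole Hilbert space, to which the Riesz theorem applies.\<close>

lemma J_surj:
  assumes \<psi>: "\<psi> \<in> X"
  obtains h where "J h = \<psi>"
proof -
  obtain Rs K where Rs: "K > 0" "\<And>h. Rs h \<in> Dstar" "\<And>h. gnorm (Rs h) \<le> K * norm h"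
    "\<And>x y. Rs (x + y) = Rs x + Rs y" "\<And>c x. Rs (c *\<^sub>C x) = c *\<^sub>C Rs x"
    "\<And>\<phi>. \<phi> \<in> Dstar \<Longrightarrow> Rs (cnj m *\<^sub>C \<phi> - Astar \<phi>) = \<phi>"
    by (rule adjoint_resolvent) blast
  obtain h where h: "\<And>x. \<psi> (Rs x) = cinner h x"
  proof (rule Riesz_antilinear[of "\<lambda>x. \<psi> (Rs x)"])
    fix x
    have "cmod (\<psi> (Rs x)) \<le> N \<psi> * (K * norm x)"
      by (intro order_trans[OF N_bound[OF \<psi> Rs(2)]] mult_left_mono Rs N_nonneg \<psi>)
    then show "cmod (\<psi> (Rs x)) \<le> (N \<psi> * K) * norm x" by (simp add: mult_ac)
  qed (auto simp: Rs X_add[OF \<psi>] X_scaleC[OF \<psi>])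
  have "J h \<phi> = \<psi> \<phi>" for \<phi>
    by (cases "\<phi> \<in> Dstar") (simp_all add: J_def Rs(6) X_outside[OF \<psi>] flip: h)
  then show ?thesis using that by blast
qed

text \<open>On \<open>D\<close> the map \<open>J\<close> is \<open>m - A\<close> followed by the
  inclusion. As \<open>m - A\<close> maps \<open>D\<close> onto the Hilbert space, the domain of the
  extension is the image of \<open>D\<close>, where the extension is \<open>A\<close> conjugated by
  \<open>J\<close>.\<close>

lemma ext_graph_J: "(J x, J y) \<in> ext_graph D A \<longleftrightarrow> x \<in> D \<and> y = A x"
proof -
  let ?ext = "\<lambda>h \<phi>. if \<phi> \<in> Dstar then cinner h (Astar \<phi>) else 0"
  have J_D: "J v = incl D A (m *\<^sub>C v - A v)" if v: "v \<in> D" for v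
    by (auto simp: J_def incl_def fun_eq_iff cinner_diff_left cinner_diff_right cinner_scaleC_left
        cinner_scaleC_right cinner_adj[OF _ v])
  have J_A: "J (A v) = ?ext (m *\<^sub>C v - A v)" if v: "v \<in> D" for v
    by (auto simp: J_def fun_eq_iff cinner_diff_left cinner_diff_right cinner_scaleC_left
        cinner_scaleC_right cinner_adj[OF _ v])
  show ?thesis
  proof
    assume "x \<in> D \<and> y = A x"
    then show "(J x, J y) \<in> ext_graph D A"
      using J_D J_A by (auto simp: ext_graph_def)
  next
    assume "(J x, J y) \<in> ext_graph D A"
    then obtain h where h: "J x = incl D A h" "J y = ?ext h"
      by (auto simp: ext_graph_def)
    let ?v = "R m h"
    have v: "?v \<in> D" "m *\<^sub>C ?v - A ?v = h" using R_in_D[OF m] R_right[OF m] by auto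
    have "J x = J ?v" "J y = J (A ?v)"
      unfolding h J_D[OF v(1)] J_A[OF v(1)] v(2) by (rule refl)+
    then have "x = ?v" "y = A ?v" by (simp_all only: J_inject)
    then show "x \<in> D \<and> y = A x" using v by simp
  qed
qed

lemma X_diff: "\<psi> \<in> X \<Longrightarrow> \<xi> \<in> X \<Longrightarrow> \<psi> - \<xi> \<in> X"
  by (metis J_in_X J_surj J_diff)

text \<open>Pulling \<open>E\<close> back along \<open>J\<close> gives a semigroup on the Hilbert
  space generated by \<open>A\<close>, so the results of \<open>semigroup_generator\<close> become
  available for the extended semigroup.\<close>

lemma conjugate_semigroup:
  assumes E: "generates_C0_semigroup_on X N (ext_graph D A) E"
  obtains E' where "generates_C0_semigroup_on UNIV norm (op_graph D A) E'"
    "\<And>t h. t \<ge> 0 \<Longrightarrow> J (E' t h) = E t (J h)"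
proof -
  have Eb: "bounded_clinear_on X N X N (E t)" if "t \<ge> 0" for t
    using that E by (simp add: generates_C0_semigroup_on_def C0_semigroup_on_def)
  have "\<exists>k. J k = E t (J h)" if "t \<ge> 0" for t h
    using Eb[OF that] J_in_X J_surj unfolding bounded_clinear_on_def by metis
  then obtain E' where J_E': "\<And>t h. t \<ge> 0 \<Longrightarrow> J (E' t h) = E t (J h)" by metis
  obtain C where C: "C > 0" "\<And>h. norm h \<le> C * N (J h)" by (rule J_lower) blast
  \<comment> \<open>By \<open>N_J_le\<close> and \<open>J_lower\<close> the norm is equivalent to
    \<open>N\<close> after \<open>J\<close>, so convergence transfers in both directions.\<close>
  have lim_iff: "((\<lambda>t. norm (f t)) \<longlongrightarrow> 0) (at_right 0) \<longleftrightarrow> ((\<lambda>t. N (J (f t))) \<longlongrightarrow> 0) (at_right 0)"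
    for f :: "real \<Rightarrow> 'h"
  proof
    assume "((\<lambda>t. norm (f t)) \<longlongrightarrow> 0) (at_right 0)"
    then have "((\<lambda>t. (cmod m + 1) * norm (f t)) \<longlongrightarrow> 0) (at_right 0)"
      by (rule tendsto_mult_right_zero)
    then show "((\<lambda>t. N (J (f t))) \<longlongrightarrow> 0) (at_right 0)"
      by (rule Lim_null_comparison[rotated]) (simp add: N_J_le N_nonneg J_in_X)
  next
    assume "((\<lambda>t. N (J (f t))) \<longlongrightarrow> 0) (at_right 0)"
    then have "((\<lambda>t. C * N (J (f t))) \<longlongrightarrow> 0) (at_right 0)"
      by (rule tendsto_mult_right_zero)
    then show "((\<lambda>t. norm (f t)) \<longlongrightarrow> 0) (at_right 0)"
      by (rule Lim_null_comparison[rotated]) (simp add: C)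
  qed
  have pos: "\<forall>\<^sub>F t in at_right 0. P t" if "\<And>t. t > 0 \<Longrightarrow> P t" for P :: "real \<Rightarrow> bool"
    using eventually_at_right_0 that by (auto elim: eventually_mono)
  have "C0_semigroup_on UNIV norm E'"
    unfolding C0_semigroup_on_def
  proof (intro conjI allI impI ballI)
    fix t :: real assume t: "t \<ge> 0"
    obtain K where K: "\<And>\<psi>. \<psi> \<in> X \<Longrightarrow> N (E t \<psi>) \<le> K * N \<psi>"
      using Eb[OF t] unfolding bounded_clinear_on_def by blast
    have "norm (E' t h) \<le> (C * \<bar>K\<bar> * (cmod m + 1)) * norm h" for h
    proof -
      have "norm (E' t h) \<le> C * N (E t (J h))" using C(2)[of "E' t h"] by (simp add: J_E' t)
      also have "\<dots> \<le> C * (\<bar>K\<bar> * N (J h))"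
        using C(1) by (intro mult_left_mono order_trans[OF K[OF J_in_X]] mult_right_mono N_nonneg J_in_X) auto
      also have "\<dots> \<le> C * (\<bar>K\<bar> * ((cmod m + 1) * norm h))"
        using C(1) by (intro mult_left_mono N_J_le) auto
      finally show ?thesis by (simp add: mult_ac)
    qed
    moreover have "E' t (x + y) = E' t x + E' t y" for x y
      using Eb[OF t] J_in_X unfolding J_inject[symmetric] bounded_clinear_on_def
      by (simp add: J_E' t J_add)
    moreover have "E' t (c *\<^sub>C x) = c *\<^sub>C E' t x" for c x
      using Eb[OF t] J_in_X unfolding J_inject[symmetric] bounded_clinear_on_def
      by (simp add: J_E' t J_scaleC)
    ultimately show "bounded_clinear (E' t)"
      unfolding bounded_clinear_on_def by blast
  next
    fix x
    show "E' 0 x = x"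
      using E J_in_X unfolding J_inject[symmetric] generates_C0_semigroup_on_def C0_semigroup_on_def
      by (simp add: J_E')
    have "((\<lambda>t. N (E t (J x) - J x)) \<longlongrightarrow> 0) (at_right 0)"
      using E J_in_X unfolding generates_C0_semigroup_on_def C0_semigroup_on_def by blast
    then show "((\<lambda>t. norm (E' t x - x)) \<longlongrightarrow> 0) (at_right 0)"
      unfolding lim_iff by (rule Lim_transform_eventually) (rule pos, simp add: J_diff J_E')
  next
    fix s t :: real and x assume "s \<ge> 0" "t \<ge> 0"
    then show "E' (s + t) x = E' s (E' t x)"
      using E J_in_X unfolding J_inject[symmetric] generates_C0_semigroup_on_def C0_semigroup_on_def
      by (simp add: J_E')
  qed
  moreover have "generator_on UNIV norm E' = op_graph D A"
  proof -
    have "(x, y) \<in> generator_on UNIV norm E' \<longleftrightarrow> (J x, J y) \<in> generator_on X N E" for x y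
    proof -
      have "J ((E' t x - x) /\<^sub>R t - y) = (E t (J x) - J x) /\<^sub>R t - J y" if "t > 0" for t
        using that by (simp add: J_diff J_scaleC J_E' scaleR_scaleC)
      then have "((\<lambda>t. N (J ((E' t x - x) /\<^sub>R t - y))) \<longlongrightarrow> 0) (at_right 0) \<longleftrightarrow>
          ((\<lambda>t. N ((E t (J x) - J x) /\<^sub>R t - J y)) \<longlongrightarrow> 0) (at_right 0)"
        by (intro filterlim_cong refl pos) simp
      then show ?thesis
        unfolding generator_on_def by (simp add: lim_iff J_in_X)
    qed
    moreover have "generator_on X N E = ext_graph D A"
      using E by (simp add: generates_C0_semigroup_on_def)
    ultimately show ?thesis
      by (auto simp: ext_graph_J op_graph_def)
  qed
  ultimately show ?thesis
    using that J_E' by (simp add: generates_C0_semigroup_on_def)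
qed

end

section \<open>Testing Bochner integrals in the dual space\<close>

context resolvent_point
begin

lemma subspace_X: "subspace X"
proof (rule subspaceI)
  fix \<psi> \<xi> and c :: real
  have J0: "J 0 = 0" using J_diff[of 0 0] by simp
  then show "0 \<in> X" using J_in_X[of 0] by simp
  assume "\<psi> \<in> X"
  then obtain h where h: "J h = \<psi>" by (rule J_surj)
  show "c *\<^sub>R \<psi> \<in> X"
    using J_in_X[of "of_real c *\<^sub>C h"] by (simp add: scaleR_scaleC J_scaleC h)
  assume "\<xi> \<in> X"
  then obtain k where "J k = \<xi>" by (rule J_surj)
  then show "\<psi> + \<xi> \<in> X"
    using J_in_X[of "h + k"] by (simp add: J_add h)
qed

text \<open>Only the simple approximations are measurable here, so the error term \<open>N (f t - s n t)\<close> is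
  never added to another integrand.\<close>

lemma Bochner_integral_eval_bound:
  assumes int: "has_Bochner_integral_on X N M f I"
    and f: "\<And>t. t \<in> space M \<Longrightarrow> f t \<in> X" and \<phi>: "\<phi> \<in> Dstar"
    and g[measurable]: "g \<in> borel_measurable M"
    and fg: "\<And>t. t \<in> space M \<Longrightarrow> cmod (f t \<phi>) \<le> g t"
    and C: "(\<integral>\<^sup>+t. ennreal (g t) \<partial>M) \<le> ennreal C" "C \<ge> 0"
  shows "cmod (I \<phi>) \<le> C"
proof -
  obtain s where s: "\<And>n. Bochner_Integration.simple_bochner_integrable M (s n)"
      "\<And>n. s n ` space M \<subseteq> X"
    and lim1: "(\<lambda>n. \<integral>\<^sup>+ t. ennreal (N (f t - s n t)) \<partial>M) \<longlonglongrightarrow> 0"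
    and lim2: "(\<lambda>n. N (Bochner_Integration.simple_bochner_integral M (s n) - I)) \<longlonglongrightarrow> 0"
    and I: "I \<in> X"
    using int unfolding has_Bochner_integral_on_def by blast
  let ?i = "\<lambda>n. Bochner_Integration.simple_bochner_integral M (s n)"
  let ?a = "\<lambda>n. \<integral>\<^sup>+ t. ennreal (N (f t - s n t)) \<partial>M"
  \<comment> \<open>The added 1 permits division by \<open>G\<close> even if the graph norm of
    \<open>\<phi>\<close> is 0.\<close>
  define G where "G = gnorm \<phi> + 1"
  have G: "G > 0" "gnorm \<phi> \<le> G" using gnorm_nonneg[of \<phi>] by (auto simp: G_def)
  have g0: "0 \<le> g t" if "t \<in> space M" for t
    using fg[OF that] norm_ge_zero order_trans by blast
  have iX: "?i n \<in> X" for n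
    unfolding simple_bochner_integral_def using s(2)
    by (intro subspace_sum[OF subspace_X] subspace_scale[OF subspace_X]) auto
  have lin: "linear (\<lambda>\<psi> :: 'h \<Rightarrow> complex. \<psi> \<phi>)"
    by (rule linearI) (auto simp: scaleR_fun_def)
  have step: "ennreal (cmod (I \<phi>)) \<le> ennreal C + (ennreal G * ?a n + ennreal G * ennreal (N (?i n - I)))" for n
  proof -
    let ?p = "\<lambda>t. s n t \<phi>"
    have p: "Bochner_Integration.simple_bochner_integrable M ?p"
      using simple_bochner_integrable_compose2[of "\<lambda>x y. x \<phi>", OF _ s(1)[of n] s(1)[of n]] by simp
    then have "simple_function M ?p" by (simp add: simple_bochner_integrable.simps)
    then have [measurable]: "?p \<in> borel_measurable M" by (rule borel_measurable_simple_function)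
    have pn: "Bochner_Integration.simple_bochner_integrable M (\<lambda>t. cmod (?p t))"
      using simple_bochner_integrable_compose2[of "\<lambda>x y. cmod x", OF _ p p] by simp
    \<comment> \<open>\<open>q\<close> is measurable, being built from \<open>?p\<close> and
      \<open>g\<close>, and lies below the error \<open>N (f t - s n t)\<close>. Integrals are added
      with \<open>q\<close>, and monotonicity alone then returns to the error.\<close>
    define q where "q t = max 0 ((cmod (?p t) - g t) / G)" for t
    have [measurable]: "q \<in> borel_measurable M" unfolding q_def by measurable
    have qN: "q t \<le> N (f t - s n t)" if t: "t \<in> space M" for t
    proof -
      have d: "f t - s n t \<in> X" using f[OF t] s(2)[of n] t by (intro X_diff) auto
      have "cmod (?p t) \<le> cmod (f t \<phi>) + cmod ((f t - s n t) \<phi>)"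
        using norm_triangle_ineq4[of "f t \<phi>" "(f t - s n t) \<phi>"] by simp
      also have "\<dots> \<le> g t + N (f t - s n t) * G"
        using N_bound[OF d \<phi>] G N_nonneg[OF d]
        by (intro add_mono fg t) (auto intro: order_trans mult_left_mono)
      finally show ?thesis
        using N_nonneg[OF d] G by (simp add: q_def field_simps)
    qed
    have "ennreal (cmod (?i n \<phi>)) = ennreal (cmod (Bochner_Integration.simple_bochner_integral M ?p))"
      by (simp add: simple_bochner_integral_linear[OF lin s(1)])
    also have "\<dots> \<le> ennreal (Bochner_Integration.simple_bochner_integral M (\<lambda>t. cmod (?p t)))"
      by (intro ennreal_leI simple_bochner_integral_norm_bound p)
    also have "\<dots> = (\<integral>\<^sup>+t. ennreal (cmod (?p t)) \<partial>M)"
      by (rule simple_bochner_integral_eq_nn_integral[OF pn]) simp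
    also have "\<dots> \<le> (\<integral>\<^sup>+t. ennreal (g t) + ennreal G * ennreal (q t) \<partial>M)"
    proof (rule nn_integral_mono)
      fix t assume t: "t \<in> space M"
      have "cmod (?p t) \<le> g t + G * q t" using G by (simp add: q_def max_def field_simps)
      then show "ennreal (cmod (?p t)) \<le> ennreal (g t) + ennreal G * ennreal (q t)"
        using G g0[OF t] by (simp add: ennreal_leI q_def flip: ennreal_plus ennreal_mult)
    qed
    also have "\<dots> = (\<integral>\<^sup>+t. ennreal (g t) \<partial>M) + ennreal G * (\<integral>\<^sup>+t. ennreal (q t) \<partial>M)"
      by (simp add: nn_integral_add nn_integral_cmult)
    also have "\<dots> \<le> ennreal C + ennreal G * ?a n"
      by (intro add_mono C mult_left_mono nn_integral_mono ennreal_leI qN) auto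
    finally have 1: "ennreal (cmod (?i n \<phi>)) \<le> ennreal C + ennreal G * ?a n" .
    have d: "?i n - I \<in> X" by (intro X_diff iX I)
    have "cmod (I \<phi>) \<le> cmod (?i n \<phi>) + cmod ((?i n - I) \<phi>)"
      using norm_triangle_ineq4[of "?i n \<phi>" "(?i n - I) \<phi>"] by simp
    also have "\<dots> \<le> cmod (?i n \<phi>) + G * N (?i n - I)"
      using N_bound[OF d \<phi>] mult_left_mono[OF G(2) N_nonneg[OF d]] by (simp add: mult.commute)
    finally have "ennreal (cmod (I \<phi>)) \<le> ennreal (cmod (?i n \<phi>)) + ennreal G * ennreal (N (?i n - I))"
      using G N_nonneg[OF d] by (simp add: ennreal_leI flip: ennreal_plus ennreal_mult)
    also have "\<dots> \<le> (ennreal C + ennreal G * ?a n) + ennreal G * ennreal (N (?i n - I))"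
      by (intro add_right_mono 1)
    finally show ?thesis by (simp add: add.assoc)
  qed
  have "(\<lambda>n. ennreal C + (ennreal G * ?a n + ennreal G * ennreal (N (?i n - I)))) \<longlonglongrightarrow>
      ennreal C + (ennreal G * 0 + ennreal G * ennreal 0)"
    by (intro tendsto_intros ennreal_tendsto_cmult lim1 tendsto_ennrealI lim2) auto
  then have "ennreal (cmod (I \<phi>)) \<le> ennreal C + (ennreal G * 0 + ennreal G * ennreal 0)"
    by (rule LIMSEQ_le_const) (use step in blast)
  then show ?thesis using C(2) by simp
qed

end

section \<open>Backward orbits of the adjoint semigroup\<close>

context resolvent_contour
begin

text \<open>The circle supplies the resolvent point on which \<open>J\<close> is based.\<close>

sublocale resolvent_point D A S "\<gamma> 0"
  by standard (rule \<gamma>_resolvent)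

text \<open>Riesz representation gives \<open>\<eta> s\<close> from \<open>Q (w s)\<close> and a
  second vector from the bounded operator \<open>A\<close> after \<open>Q (w s)\<close>. By
  \<open>Q_A\<close> the second is the adjoint image of the first. Both decay since exp (- s l) has
  modulus at most exp (- \<omega> s) on the circle.\<close>

lemma adjoint_backward_orbit:
  assumes \<omega>: "\<And>\<theta>. \<omega> \<le> Re (\<gamma> \<theta>)"
  obtains \<eta> C where "C > 0" "\<And>s. s \<ge> 0 \<Longrightarrow> \<eta> s \<in> Dstar"
    "\<And>s. s \<ge> 0 \<Longrightarrow> gnorm (\<eta> s) \<le> C * exp (- \<omega> * s)"
    "\<And>s h. s \<ge> 0 \<Longrightarrow> cinner (Q (w s) h) x = cinner h (\<eta> s)"
    "\<And>s h. s \<ge> 0 \<Longrightarrow> cinner (A (Q (w s) h)) x = cinner h (Astar (\<eta> s))"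
proof -
  obtain M where M: "M > 0" "\<And>f C h. continuous_on {0..2 * pi} f \<Longrightarrow>
      (\<And>\<theta>. \<theta> \<in> {0..2 * pi} \<Longrightarrow> cmod (f \<theta>) \<le> C) \<Longrightarrow> norm (Q f h) \<le> M * C * norm h"
    using Q_norm_bound by metis
  have w_bound: "cmod (w s \<theta>) \<le> exp (- \<omega> * s) * r" if "s \<ge> 0" for s \<theta>
  proof -
    have "cmod (w s \<theta>) = exp (- s * Re (\<gamma> \<theta>)) * r"
      using r_pos by (simp add: w_def norm_mult)
    also have "\<dots> \<le> exp (- \<omega> * s) * r"
      using r_pos mult_left_mono[OF \<omega> that] by (intro mult_right_mono) (auto simp: mult.commute)
    finally show ?thesis .
  qed
  define L where "L = cmod z + r"
  have L: "L > 0" using r_pos by (simp add: L_def add_nonneg_pos)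
  have \<gamma>_bound: "cmod (\<gamma> \<theta>) \<le> L" for \<theta>
    unfolding L_def \<gamma>_def using r_pos norm_triangle_ineq[of z "of_real r * cis \<theta>"] by (simp add: norm_mult)
  have cw: "continuous_on {0..2 * pi} (\<lambda>\<theta>. \<gamma> \<theta> * w s \<theta>)" for s
    by (intro continuous_intros)
  \<comment> \<open>In \<open>1 + L\<close> the summands account for \<open>a\<close> and
    \<open>Astar a\<close>; \<open>norm x + 1\<close> keeps the constant positive for
    \<open>x = 0\<close>.\<close>
  have "\<exists>a. s \<ge> 0 \<longrightarrow> a \<in> Dstar \<and> gnorm a \<le> (M * r * (1 + L) * (norm x + 1)) * exp (- \<omega> * s) \<and>
      (\<forall>h. cinner (Q (w s) h) x = cinner h a) \<and> (\<forall>h. cinner (A (Q (w s) h)) x = cinner h (Astar a))" for s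
  proof (cases "s \<ge> 0")
    case True
    let ?e = "exp (- \<omega> * s)"
    have 1: "norm (Q (w s) h) \<le> M * (?e * r) * norm h" for h
      by (rule M(2)[OF continuous_on_w w_bound[OF True]])
    have 2: "norm (Q (\<lambda>\<theta>. \<gamma> \<theta> * w s \<theta>) h) \<le> M * (L * (?e * r)) * norm h" for h
      using L by (intro M(2)[OF cw]) (auto simp: norm_mult intro!: mult_mono \<gamma>_bound w_bound[OF True, simplified])
    obtain a where a: "\<And>h. cinner (Q (w s) h) x = cinner h a" "norm a \<le> M * (?e * r) * norm x"
      using bounded_adjoint_exists[OF Q_bounded[OF continuous_on_w] 1, of x] M(1) r_pos by auto
    obtain b where b: "\<And>h. cinner (A (Q (w s) h)) x = cinner h b" "norm b \<le> M * (L * (?e * r)) * norm x"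
      using bounded_adjoint_exists[OF Q_bounded[OF cw] 2, of x] M(1) L r_pos by (auto simp: A_Q_w)
    have ab: "cinner (A h) a = cinner h b" if "h \<in> D" for h
      unfolding a(1)[symmetric] b(1)[symmetric] Q_A[OF continuous_on_w that] ..
    note ab = adj_unique[OF ab]
    have "gnorm a \<le> M * (?e * r) * norm x + M * (L * (?e * r)) * norm x"
      using gnorm_le[of a] a(2) b(2) by (simp add: ab)
    also have "\<dots> = (M * r * (1 + L) * norm x) * ?e" by (simp add: algebra_simps)
    also have "\<dots> \<le> (M * r * (1 + L) * (norm x + 1)) * ?e"
      using M(1) r_pos L by (intro mult_right_mono mult_left_mono) auto
    finally show ?thesis using a(1) b(1) ab by (intro exI[of _ a]) auto
  qed simp
  then obtain \<eta> where "\<And>s. s \<ge> 0 \<longrightarrow> \<eta> s \<in> Dstar \<and>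
      gnorm (\<eta> s) \<le> (M * r * (1 + L) * (norm x + 1)) * exp (- \<omega> * s) \<and>
      (\<forall>h. cinner (Q (w s) h) x = cinner h (\<eta> s)) \<and>
      (\<forall>h. cinner (A (Q (w s) h)) x = cinner h (Astar (\<eta> s)))"
    by metis
  then show ?thesis
    using M(1) r_pos L by (intro that[of "M * r * (1 + L) * (norm x + 1)" \<eta>]) (auto simp: add_nonneg_pos)
qed

text \<open>With \<open>\<psi> = J h\<close>, evaluation at \<open>\<eta>\<close> pairs
  \<open>h\<close> with \<open>x\<close> through \<open>Q (w (s + t))\<close> and its image under
  \<open>A\<close>. The evolution for time \<open>t\<close> turns \<open>Q (w (s + t))\<close> into
  \<open>Q (w s)\<close>, which is evaluation at \<open>\<phi>\<close>.\<close>

lemma extension_backward_orbit: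
  assumes E: "generates_C0_semigroup_on X N (ext_graph D A) E"
    and \<psi>: "\<psi> \<in> X" and t: "t \<ge> 0" and \<eta>D: "\<eta> \<in> Dstar"
    and \<eta>: "\<And>h. cinner (Q (w (s + t)) h) x = cinner h \<eta>"
      "\<And>h. cinner (A (Q (w (s + t)) h)) x = cinner h (Astar \<eta>)"
    and \<phi>D: "\<phi> \<in> Dstar"
    and \<phi>: "\<And>h. cinner (Q (w s) h) x = cinner h \<phi>"
      "\<And>h. cinner (A (Q (w s) h)) x = cinner h (Astar \<phi>)"
  shows "E t \<psi> \<eta> = \<psi> \<phi>"
proof -
  obtain E' where E': "generates_C0_semigroup_on UNIV norm (op_graph D A) E'"
    "\<And>t h. t \<ge> 0 \<Longrightarrow> J (E' t h) = E t (J h)"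
    using conjugate_semigroup[OF E] by blast
  \<comment> \<open>\<open>Q\<close> depends on \<open>D\<close>, \<open>A\<close> and the circle
    but not on the semigroup, so both interpretations share the same contour operators.\<close>
  interpret E': resolvent_contour D A E' z r
    by standard (use E' r_pos sphere_resolvent in auto)
  obtain h where h: "J h = \<psi>" using \<psi> by (rule J_surj)
  have *: "Q (w (s + t)) (E' t h) = Q (w s) h"
    using E'.S_Q[OF continuous_on_w t, of "s + t" h] E'.S_Q_w_add[OF t, of s h] by simp
  have "E t \<psi> \<eta> = J (E' t h) \<eta>" by (simp add: E'(2) t h)
  also have "\<dots> = J h \<phi>"
    by (simp add: J_def \<eta>D \<phi>D cinner_diff_right cinner_scaleC_right * flip: \<eta> \<phi>)
  finally show ?thesis by (simp add: h)
qed

end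

section \<open>The energy estimate\<close>

text \<open>An interval of length 1 beyond \<open>T\<close> has positive measure and cannot lie
  inside the exceptional null set.\<close>

lemma AE_lebesgue_exists_greater:
  assumes "AE t in lebesgue_on {0..}. P t"
  obtains t :: real where "t > T" "t \<ge> 0" "P t"
proof -
  have "AE t in lebesgue. t \<in> {0..} \<longrightarrow> P t"
    using assms by (subst (asm) AE_restrict_space_iff) auto
  then obtain N where N: "{t. \<not> (t \<in> {0..} \<longrightarrow> P t)} \<subseteq> N" "emeasure lebesgue N = 0" "N \<in> sets lebesgue"
    by (auto elim: AE_E)
  have "\<not> {max T 0<..<max T 0 + 1} \<subseteq> N"
  proof
    assume "{max T 0<..<max T 0 + 1} \<subseteq> N"
    then have "emeasure lebesgue {max T 0<..<max T 0 + 1} \<le> emeasure lebesgue N"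
      using N(3) by (rule emeasure_mono)
    then show False using N(2) by simp
  qed
  then obtain t where "t > max T 0" "t \<notin> N"
    by (meson greaterThanLessThan_iff subsetI)
  then show ?thesis using that[of t] subsetD[OF N(1), of t] by auto
qed

text \<open>The integral over the half line defaults to 0 for a non-integrable function, so an
  energy bound has content only once it is tied to a finite interval. Measurability on the half line
  comes from truncations.\<close>

lemma L2_loc_supported_integral:
  assumes u: "u \<in> L2_loc" and supp: "supported_in T u" and t: "T < t" "0 < t"
  shows "(\<integral>s. (norm (u s))\<^sup>2 \<partial>lebesgue_on {0..}) = (\<integral>s. (norm (u s))\<^sup>2 \<partial>lebesgue_on {0..t})"
proof -
  let ?q = "\<lambda>s. (norm (u s))\<^sup>2"
  have int: "integrable (lebesgue_on {0..b}) ?q" if "b > 0" for b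
    using u that by (auto simp: L2_loc_def L2_on_def)
  have meas: "(\<lambda>s. indicator {0..b} s *\<^sub>R ?q s) \<in> borel_measurable lebesgue" if "b > 0" for b
    using borel_measurable_integrable[OF int[OF that]]
    by (subst (asm) borel_measurable_restrict_space_iff) auto
  have "(\<lambda>s. indicator {0..} s *\<^sub>R ?q s) \<in> borel_measurable lebesgue"
  proof (rule borel_measurable_LIMSEQ_real)
    fix s :: real
    obtain n :: nat where n: "s \<le> n" using real_arch_simple by blast
    \<comment> \<open>\<open>Suc n\<close> makes every truncation interval nondegenerate, as the
      local hypothesis speaks only of positive end points.\<close>
    show "(\<lambda>n. indicator {0..real (Suc n)} s *\<^sub>R ?q s) \<longlonglongrightarrow> indicator {0..} s *\<^sub>R ?q s"
      by (rule tendsto_eventually, rule eventually_sequentiallyI[of n])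
         (use n in \<open>auto simp: indicator_def\<close>)
  qed (rule meas, simp)
  moreover have "AE s in lebesgue. indicator {0..} s *\<^sub>R ?q s = indicator {0..t} s *\<^sub>R ?q s"
  proof -
    have "AE s in lebesgue. s \<in> {0..} \<longrightarrow> T < s \<longrightarrow> u s = 0"
      using supp unfolding supported_in_def by (subst (asm) AE_restrict_space_iff) auto
    then show ?thesis
      by eventually_elim (use t in \<open>auto simp: indicator_def\<close>)
  qed
  ultimately have "(\<integral>s. indicator {0..} s *\<^sub>R ?q s \<partial>lebesgue) = (\<integral>s. indicator {0..t} s *\<^sub>R ?q s \<partial>lebesgue)"
    by (intro integral_cong_AE meas t)
  then show ?thesis by (simp add: integral_restrict_space)
qed

lemma integral_exp_decay:
  fixes \<omega> t :: real
  assumes "\<omega> > 0" "t \<ge> 0"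
  shows "integrable (lebesgue_on {0..t}) (\<lambda>s. exp (- (2 * \<omega>) * s))"
    and "(\<integral>s. exp (- (2 * \<omega>) * s) \<partial>lebesgue_on {0..t}) \<le> 1 / (2 * \<omega>)"
proof -
  show int: "integrable (lebesgue_on {0..t}) (\<lambda>s. exp (- (2 * \<omega>) * s))"
    by (intro continuous_imp_integrable_real continuous_intros)
  have "((\<lambda>s. exp (- (2 * \<omega>) * s)) has_integral
      - exp (- (2 * \<omega>) * t) / (2 * \<omega>) - - exp (- (2 * \<omega>) * 0) / (2 * \<omega>)) {0..t}"
    using assms
    by (intro fundamental_theorem_of_calculus)
       (auto intro!: derivative_eq_intros simp flip: has_real_derivative_iff_has_vector_derivative)
  then have "integral {0..t} (\<lambda>s. exp (- (2 * \<omega>) * s)) \<le> 1 / (2 * \<omega>)"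
    using assms by (simp add: integral_unique field_simps)
  then show "(\<integral>s. exp (- (2 * \<omega>) * s) \<partial>lebesgue_on {0..t}) \<le> 1 / (2 * \<omega>)"
    by (subst lebesgue_integral_eq_integral[OF int]) auto
qed

context resolvent_contour
begin

lemma spectral_point_imp_not_NCVE:
  fixes B :: "'u::complex_hilbert \<Rightarrow> 'h \<Rightarrow> complex"
  assumes E: "generates_C0_semigroup_on X N (ext_graph D A) E"
    and B: "bounded_clinear_on UNIV norm X N B"
    and \<omega>: "\<omega> > 0" "\<And>\<theta>. \<omega> \<le> Re (\<gamma> \<theta>)" and z: "z \<in> spectrum D A"
  shows "\<not> NCVE D A S E B"
proof
  assume NCVE: "NCVE D A S E B"
  obtain y where y: "Q (w 0) y \<noteq> 0" using Q_w_0_nonzero[OF z] by blast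
  \<comment> \<open>With this choice the pairing of \<open>Q (w 0) y\<close> with \<open>x\<close>
    is the squared norm of \<open>x\<close>, which is not 0.\<close>
  define x where "x = Q (w 0) y"
  obtain \<eta> C where C: "C > 0" and \<eta>: "\<And>s. s \<ge> 0 \<Longrightarrow> \<eta> s \<in> Dstar"
    "\<And>s. s \<ge> 0 \<Longrightarrow> gnorm (\<eta> s) \<le> C * exp (- \<omega> * s)"
    "\<And>s h. s \<ge> 0 \<Longrightarrow> cinner (Q (w s) h) x = cinner h (\<eta> s)"
    "\<And>s h. s \<ge> 0 \<Longrightarrow> cinner (A (Q (w s) h)) x = cinner h (Astar (\<eta> s))"
    by (rule adjoint_backward_orbit[OF \<omega>(2), of x]) (rule that)
  obtain K0 where K0: "\<And>v. N (B v) \<le> K0 * norm v"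
    using B unfolding bounded_clinear_on_def by blast
  define K where "K = \<bar>K0\<bar> * C"
  have K: "K \<ge> 0" using C by (simp add: K_def)
  have BX: "B v \<in> X" for v using B by (auto simp: bounded_clinear_on_def)
  have EX: "E t \<psi> \<in> X" if "t \<ge> 0" "\<psi> \<in> X" for t \<psi>
    using E that by (auto simp: generates_C0_semigroup_on_def C0_semigroup_on_def bounded_clinear_on_def)
  have est: "(norm x)\<^sup>2 \<le> (K / 2 * (1 / (2 * \<omega>) + 1)) * \<epsilon>" if \<epsilon>: "\<epsilon> > 0" for \<epsilon>
  proof -
    obtain T u v where u: "u \<in> L2_loc" "supported_in T u"
      and energy: "(\<integral>s. (norm (u s))\<^sup>2 \<partial>lebesgue_on {0..}) \<le> \<epsilon>\<^sup>2"
      and v: "is_solution D A S E B y u v" "supported_in T v"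
      using NCVE \<epsilon> unfolding NCVE_def NCVE_element_def steers_to_rest_def by meson
    have "AE t in lebesgue_on {0..}. (\<exists>\<psi>. has_response D A E B u t \<psi> \<and>
        incl D A (v t) = incl D A (S t y) + \<psi>) \<and> (T < t \<longrightarrow> v t = 0)"
      using v unfolding is_solution_def supported_in_def by auto
    \<comment> \<open>The solution formula and the rest condition hold only almost everywhere, so a
      common good time after \<open>T\<close> is picked.\<close>
    then obtain t \<psi> where t: "t > max T 0" and \<psi>: "has_response D A E B u t \<psi>"
        "incl D A 0 = incl D A (S t y) + \<psi>"
      by (rule AE_lebesgue_exists_greater[of _ "max T 0"]) auto
    have t': "T < t" "0 < t" using t by auto
    \<comment> \<open>Growth of \<open>S t\<close> and decay of \<open>\<eta> t\<close> compensate
      exactly: the free evolution contributes the squared norm of \<open>x\<close>, independently of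
      \<open>t\<close>.\<close>
    have "cinner (S t y) (\<eta> t) = cinner (S t (Q (w t) y)) x"
      using \<eta>(3)[of t "S t y"] S_Q[OF continuous_on_w, of t t y] t' by simp
    also have "\<dots> = (norm x)\<^sup>2" using S_Q_w[of t y] t' by (simp add: cinner_self x_def)
    finally have "\<psi> (\<eta> t) = - ((norm x)\<^sup>2)"
      using fun_cong[OF \<psi>(2), of "\<eta> t"] \<eta>(1)[of t] t'
      by (simp add: incl_def add_eq_0_iff)
    then have \<psi>_norm: "cmod (\<psi> (\<eta> t)) = (norm x)\<^sup>2"
      by (simp add: norm_power)
    \<comment> \<open>Young's inequality with parameter \<open>\<epsilon>\<close>: the product of
      exp (- \<omega> s) and the norm of \<open>u s\<close> splits so that, for energy at most
      \<open>\<epsilon>\<^sup>2\<close>, both parts integrate to a multiple of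
      \<open>\<epsilon>\<close>.\<close>
    define g where "g s = K / 2 * (\<epsilon> * exp (- (2 * \<omega>) * s) + (norm (u s))\<^sup>2 / \<epsilon>)" for s
    have int_u: "integrable (lebesgue_on {0..t}) (\<lambda>s. (norm (u s))\<^sup>2)"
      using u t' by (auto simp: L2_loc_def L2_on_def)
    note int_e = integral_exp_decay[OF \<omega>(1), of t]
    have int_g: "integrable (lebesgue_on {0..t}) g"
      unfolding g_def using int_u int_e(1) t' by auto
    have "(\<integral>s. g s \<partial>lebesgue_on {0..t}) =
        K / 2 * (\<epsilon> * (\<integral>s. exp (- (2 * \<omega>) * s) \<partial>lebesgue_on {0..t}) + (\<integral>s. (norm (u s))\<^sup>2 \<partial>lebesgue_on {0..t}) / \<epsilon>)"
      unfolding g_def using int_u int_e(1) t' by simp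
    also have "\<dots> \<le> K / 2 * (\<epsilon> * (1 / (2 * \<omega>)) + \<epsilon>\<^sup>2 / \<epsilon>)"
      using K \<epsilon> int_e(2) t' energy unfolding L2_loc_supported_integral[OF u t']
      by (intro mult_left_mono add_mono divide_right_mono) auto
    also have "\<dots> = (K / 2 * (1 / (2 * \<omega>) + 1)) * \<epsilon>"
      using \<epsilon> by (simp add: algebra_simps power2_eq_square)
    finally have g_le: "(\<integral>s. g s \<partial>lebesgue_on {0..t}) \<le> (K / 2 * (1 / (2 * \<omega>) + 1)) * \<epsilon>" .
    have "cmod (\<psi> (\<eta> t)) \<le> (K / 2 * (1 / (2 * \<omega>) + 1)) * \<epsilon>"
    proof (rule Bochner_integral_eval_bound)
      show "has_Bochner_integral_on X N (lebesgue_on {0..t}) (\<lambda>s. E (t - s) (B (u s))) \<psi>"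
        using \<psi>(1) by (simp add: has_response_def)
      show "\<eta> t \<in> Dstar" using \<eta>(1) t' by simp
      show "g \<in> borel_measurable (lebesgue_on {0..t})"
        using int_g by (rule borel_measurable_integrable)
      have "(\<integral>\<^sup>+s. ennreal (g s) \<partial>lebesgue_on {0..t}) = ennreal (\<integral>s. g s \<partial>lebesgue_on {0..t})"
        using K \<epsilon> by (intro nn_integral_eq_integral int_g) (auto simp: g_def)
      then show "(\<integral>\<^sup>+s. ennreal (g s) \<partial>lebesgue_on {0..t}) \<le> ennreal ((K / 2 * (1 / (2 * \<omega>) + 1)) * \<epsilon>)"
        using g_le by (simp add: ennreal_leI)
      show "0 \<le> (K / 2 * (1 / (2 * \<omega>) + 1)) * \<epsilon>" using K \<omega>(1) \<epsilon> by simp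
    next
      fix s assume "s \<in> space (lebesgue_on {0..t})"
      then have s: "0 \<le> s" "0 \<le> t - s" "s + (t - s) = t" by auto
      show "E (t - s) (B (u s)) \<in> X" by (intro EX s BX)
      \<comment> \<open>The backward orbit cancels the propagation from \<open>s\<close> to
        \<open>t\<close>, so the estimate no longer involves the growth of \<open>E\<close>.\<close>
      have "E (t - s) (B (u s)) (\<eta> t) = B (u s) (\<eta> s)"
        using \<eta> s t' by (intro extension_backward_orbit[OF E BX, where s = s and x = x]) auto
      then have "cmod (E (t - s) (B (u s)) (\<eta> t)) \<le> N (B (u s)) * gnorm (\<eta> s)"
        using N_bound[OF BX \<eta>(1)[OF s(1)]] by simp
      also have "\<dots> \<le> (\<bar>K0\<bar> * norm (u s)) * (C * exp (- \<omega> * s))"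
        using C by (intro mult_mono \<eta>(2) s gnorm_nonneg order_trans[OF K0] mult_right_mono) auto
      also have "\<dots> = K * (exp (- \<omega> * s) * norm (u s))" by (simp add: K_def)
      also have "\<dots> \<le> g s"
      proof -
        let ?a = "exp (- \<omega> * s)" and ?b = "norm (u s)"
        have "0 \<le> (\<epsilon> * ?a - ?b)\<^sup>2 / \<epsilon>" using \<epsilon> by simp
        also have "\<dots> = \<epsilon> * ?a\<^sup>2 + ?b\<^sup>2 / \<epsilon> - 2 * (?a * ?b)"
          using \<epsilon> by (simp add: power2_eq_square field_simps)
        finally have "?a * ?b \<le> (\<epsilon> * ?a\<^sup>2 + ?b\<^sup>2 / \<epsilon>) / 2" by simp
        moreover have "?a\<^sup>2 = exp (- (2 * \<omega>) * s)"
          by (simp flip: exp_of_nat_mult)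
        ultimately have "?a * ?b \<le> (\<epsilon> * exp (- (2 * \<omega>) * s) + ?b\<^sup>2 / \<epsilon>) / 2"
          by (simp only:)
        from mult_left_mono[OF this K] show ?thesis by (simp add: g_def)
      qed
      finally show "cmod (E (t - s) (B (u s)) (\<eta> t)) \<le> g s" .
    qed
    then show ?thesis by (simp add: \<psi>_norm)
  qed
  define c where "c = K / 2 * (1 / (2 * \<omega>) + 1)"
  have c: "c \<ge> 0" using K \<omega>(1) by (simp add: c_def)
  have "(norm x)\<^sup>2 \<le> 0"
  proof (rule field_le_epsilon)
    fix e :: real assume e: "e > 0"
    \<comment> \<open>Dividing by \<open>c + 1\<close> covers the case \<open>c = 0\<close>.\<close>
    have "e / (c + 1) > 0" using c e by simp
    then have "(norm x)\<^sup>2 \<le> c * (e / (c + 1))" by (rule est[folded c_def])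
    also have "\<dots> \<le> e" using c e by (simp add: field_simps)
    finally show "(norm x)\<^sup>2 \<le> 0 + e" by simp
  qed
  then show False using y by (simp add: x_def)
qed

end

section \<open>Choosing the circle around the isolated spectral point\<close>

theorem corollary1p6:
  fixes D :: "'h::complex_hilbert set"
    and A :: "'h \<Rightarrow> 'h"
    and S :: "real \<Rightarrow> 'h \<Rightarrow> 'h"
    and E :: "real \<Rightarrow> ('h \<Rightarrow> complex) \<Rightarrow> ('h \<Rightarrow> complex)"
    and B :: "'u::complex_hilbert \<Rightarrow> ('h \<Rightarrow> complex)"
    and z :: complex
  assumes "generates_C0_semigroup_on UNIV norm (op_graph D A) S"
    and "generates_C0_semigroup_on (adj_dual D A) (adj_dual_norm D A) (ext_graph D A) E"
    and "bounded_clinear_on UNIV norm (adj_dual D A) (adj_dual_norm D A) B"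
    and "\<And>T. T > 0 \<Longrightarrow> response_map_continuous D A E B T"
    and "z isolated_in spectrum D A"
    and "Re z > 0"
  shows "\<not> NCVE D A S E B"
proof -
  obtain e where z: "z \<in> spectrum D A" and e: "e > 0" "\<And>l. l \<in> spectrum D A \<Longrightarrow> dist z l < e \<Longrightarrow> l = z"
    using assms(5) by (auto simp: isolated_in_dist_Ex_iff)
  \<comment> \<open>\<open>r < e\<close> keeps the circle off the spectrum, and
    \<open>r \<le> Re z / 2\<close> keeps it in the half plane with real part at least
    \<open>Re z / 2\<close>, which serves as the decay rate.\<close>
  define r where "r = min e (Re z) / 2"
  have r: "0 < r" "r < e" "r \<le> Re z / 2" using e assms(6) by (auto simp: r_def)
  have "sphere z r \<subseteq> resolvent_set D A"
    using e(2) r by (fastforce simp: spectrum_def)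
  then interpret resolvent_contour D A S z r
    by unfold_locales (use assms r in auto)
  have "Re z / 2 \<le> Re (\<gamma> \<theta>)" for \<theta>
  proof -
    have "- r \<le> r * cos \<theta>" using r mult_left_mono[OF cos_ge_minus_one, of r \<theta>] by simp
    then show ?thesis using r by (simp add: \<gamma>_def)
  qed
  then show ?thesis
    using assms z by (intro spectral_point_imp_not_NCVE[where \<omega> = "Re z / 2"]) auto
qed

end
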